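(* Let $q$ be a prime power and $X\subseteq\mathbb{P}^2$ the Hermitian curve over $\mathbb{F}_{q^2}$. Fix integers $s,d$ with $2\le s\le d-1\le q-2$ and integers $a_1,\dots,a_s$ with $0<a_i\le d+1-i$ for all $i\in\{1,\dots,s\}$ and $a_1+\dots+a_s\le 3d-7+s$. Fix $s$ distinct collinear points $P_1,\dots,P_s\in X(\mathbb{F}_{q^2})$ and let $R$ be the line containing them. Set $B:=X(\mathbb{F}_{q^2})\setminus\{P_1,\dots,P_s\}$ and $E:=\sum_{i=1}^s a_iP_i$, and let $\mathcal{C}=\mathcal{C}(B,d,-E)$. Then $\mathcal{C}$ has length $n=q^3+1-s$ and dimension $k=\binom{d+2}{2}-\sum_{i=1}^s a_i$. The code $\mathcal{C}^\perp$ has minimum distance $d+2-s$, and its minimum-weight codewords are exactly those whose support consists of $d+2-s$ points of $B\cap R$. Every $S\subseteq R\cap B$ with $|S|=d+2-s$ is the support of exactly one (up to multiplication by a nonzero scalar) minimum-weight codeword.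
   Context: $\mathbb{P}^2$ is the projective plane over $\mathbb{F}_{q^2}$ with coordinates $(x:y:z)$; the Hermitian curve $X$ is the plane curve with affine equation $y+y^q=x^{q+1}$ (smooth, degree $q+1$, with $q^3+1$ rational points). $E$ is viewed both as a divisor on $X$ and as a zero-dimensional subscheme of $\mathbb{P}^2$. $\mathcal{C}(B,d,-E)$ denotes the code obtained by evaluating $H^0(X,\mathcal{O}_X(d)(-E))$ (degree-$d$ forms on $X$ vanishing on the scheme $E$) at the points of $B$, after fixing a coordinate representative of each point; coordinates are indexed by $B$. $\mathcal{C}^\perp$ is the dual code with respect to the standard dot product; weight = number of nonzero coordinates; support = set of points indexing nonzero coordinates; minimum distance = minimal weight of a nonzero codeword. *)

theory Defs
  imports "HOL-Computational_Algebra.Formal_Power_Series"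
          "HOL-Computational_Algebra.Primes"
          "HOL-Library.Function_Algebras"
begin

(* Homogeneous coordinates (x,y,z); a point of P^2 is the set of its nonzero representatives *)
type_synonym 'a pt3 = "'a \<times> 'a \<times> 'a"

definition proj_class :: "'a::field pt3 \<Rightarrow> 'a pt3 set" where
  "proj_class v = {(c * fst v, c * fst (snd v), c * snd (snd v)) | c. c \<noteq> 0}"

definition proj_plane :: "'a::field pt3 set set" where
  "proj_plane = {proj_class v | v. v \<noteq> (0, 0, 0)}"

definition prime_power :: "nat \<Rightarrow> bool" where
  "prime_power q \<longleftrightarrow> (\<exists>p k. prime p \<and> k > 0 \<and> q = p ^ k)"

(* Hermitian form: y z^q + y^q z - x^(q+1); affinely (z=1) y + y^q = x^(q+1) *)
definition herm_poly :: "nat \<Rightarrow> 'a::comm_ring_1 \<Rightarrow> 'a \<Rightarrow> 'a \<Rightarrow> 'a" where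
  "herm_poly q x y z = y * z ^ q + y ^ q * z - x ^ (q + 1)"

(* rational points of the Hermitian curve over the base field 'a (which is F_{q^2}) *)
definition herm_points :: "nat \<Rightarrow> 'a::field pt3 set set" where
  "herm_points q = {P \<in> proj_plane. \<forall>(x, y, z) \<in> P. herm_poly q x y z = 0}"

definition proj_line :: "'a::field \<Rightarrow> 'a \<Rightarrow> 'a \<Rightarrow> 'a pt3 set set" where
  "proj_line \<alpha> \<beta> \<gamma> = {P \<in> proj_plane. \<forall>(x, y, z) \<in> P. \<alpha> * x + \<beta> * y + \<gamma> * z = 0}"

definition is_line :: "'a::field pt3 set set \<Rightarrow> bool" where
  "is_line R \<longleftrightarrow> (\<exists>\<alpha> \<beta> \<gamma>. (\<alpha>, \<beta>, \<gamma>) \<noteq> (0, 0, 0) \<and> R = proj_line \<alpha> \<beta> \<gamma>)"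

definition form_eval :: "nat \<Rightarrow> (nat \<Rightarrow> nat \<Rightarrow> 'a::comm_ring_1) \<Rightarrow> 'a \<Rightarrow> 'a \<Rightarrow> 'a \<Rightarrow> 'a" where
  "form_eval d c x y z = (\<Sum>i\<le>d. \<Sum>j\<le>d - i. c i j * x ^ i * y ^ j * z ^ (d - i - j))"

definition form_eval_fps :: "nat \<Rightarrow> (nat \<Rightarrow> nat \<Rightarrow> 'a::field) \<Rightarrow> 'a fps \<Rightarrow> 'a fps \<Rightarrow> 'a fps \<Rightarrow> 'a fps" where
  "form_eval_fps d c X Y Z =
     (\<Sum>i\<le>d. \<Sum>j\<le>d - i. fps_const (c i j) * X ^ i * Y ^ j * Z ^ (d - i - j))"

(* a formal smooth germ of the Hermitian curve centred at P: (X(t):Y(t):Z(t)) lies on the curve,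
   its value at t=0 represents P, and its tangent vector is not proportional to the base point *)
definition herm_germ :: "nat \<Rightarrow> 'a::field pt3 set \<Rightarrow> 'a fps \<Rightarrow> 'a fps \<Rightarrow> 'a fps \<Rightarrow> bool" where
  "herm_germ q P X Y Z \<longleftrightarrow>
     (fps_nth X 0, fps_nth Y 0, fps_nth Z 0) \<in> P \<and> herm_poly q X Y Z = 0 \<and>
     \<not> (\<exists>c. fps_nth X 1 = c * fps_nth X 0 \<and> fps_nth Y 1 = c * fps_nth Y 0
             \<and> fps_nth Z 1 = c * fps_nth Z 0)"

(* the form vanishes on the length-a subscheme a*P of the curve X, i.e. the
   intersection multiplicity of the form with X at P is at least a *)
definition vanishes_on_multpoint ::
  "nat \<Rightarrow> nat \<Rightarrow> (nat \<Rightarrow> nat \<Rightarrow> 'a::field) \<Rightarrow> 'a pt3 set \<Rightarrow> nat \<Rightarrow> bool" where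
  "vanishes_on_multpoint q d c P a \<longleftrightarrow>
     (\<forall>X Y Z. herm_germ q P X Y Z \<longrightarrow> (\<forall>n<a. fps_nth (form_eval_fps d c X Y Z) n = 0))"

(* C(B, d, -E) with E = sum_{i=1..s} a_i P_i; codewords are functions on points, zero off B;
   rep fixes a coordinate representative of each point of B *)
definition herm_code ::
  "nat \<Rightarrow> nat \<Rightarrow> 'a::field pt3 set set \<Rightarrow> ('a pt3 set \<Rightarrow> 'a pt3)
   \<Rightarrow> nat \<Rightarrow> (nat \<Rightarrow> 'a pt3 set) \<Rightarrow> (nat \<Rightarrow> nat) \<Rightarrow> ('a pt3 set \<Rightarrow> 'a) set" where
  "herm_code q d B rep s P a =
     {(\<lambda>Q. if Q \<in> B then (case rep Q of (x, y, z) \<Rightarrow> form_eval d c x y z) else 0) | c.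
        \<forall>i\<in>{1..s}. vanishes_on_multpoint q d c (P i) (a i)}"

definition dual_code :: "'p set \<Rightarrow> ('p \<Rightarrow> 'a::field) set \<Rightarrow> ('p \<Rightarrow> 'a) set" where
  "dual_code B C = {w. (\<forall>Q. Q \<notin> B \<longrightarrow> w Q = 0) \<and> (\<forall>v\<in>C. (\<Sum>Q\<in>B. v Q * w Q) = 0)}"

definition supp :: "'p set \<Rightarrow> ('p \<Rightarrow> 'a::zero) \<Rightarrow> 'p set" where
  "supp B w = {Q \<in> B. w Q \<noteq> 0}"

definition weight :: "'p set \<Rightarrow> ('p \<Rightarrow> 'a::zero) \<Rightarrow> nat" where
  "weight B w = card (supp B w)"

definition min_dist :: "'p set \<Rightarrow> ('p \<Rightarrow> 'a::zero) set \<Rightarrow> nat" where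
  "min_dist B C = Min {weight B w | w. w \<in> C \<and> w \<noteq> 0}"

definition fscale :: "'a::field \<Rightarrow> ('p \<Rightarrow> 'a) \<Rightarrow> ('p \<Rightarrow> 'a)" where
  "fscale c f = (\<lambda>x. c * f x)"

definition code_dim :: "('p \<Rightarrow> 'a::field) set \<Rightarrow> nat" where
  "code_dim C = vector_space.dim fscale C"

end

theory Submission
  imports Defs "HOL-Computational_Algebra.Polynomial"
begin

text \<open>
  The tangent \<open>T\<^sub>i\<close> of the Hermitian curve at \<open>P\<^sub>i\<close> meets the curve with multiplicity
  \<open>q + 1\<close> at \<open>P\<^sub>i\<close> and has no other rational point on it. As \<open>a\<^sub>i \<le> q\<close>, vanishing on
  \<open>a\<^sub>iP\<^sub>i\<close> is a condition on the restriction of a form to \<open>T\<^sub>i\<close>. Splitting off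
  \<open>T\<^sub>1, \<dots>, T\<^sub>s\<close> one after the other shows that \<open>E\<close> imposes independent conditions on
  forms of degree \<open>d\<close> and even of degree \<open>d - 1\<close>. Together with the injectivity of
  evaluation in degree less than \<open>q\<close> this gives the dimension.

  Let \<open>S\<close> be the support of a dual word, with at most \<open>d + 2 - s\<close> points. The product of
  the \<open>T\<^sub>i\<close> vanishes on \<open>E\<close> and nowhere on \<open>S\<close>, so forms of degree \<open>d - s\<close> cannot separate
  a point of \<open>S\<close> from the others; hence \<open>S\<close> consists of \<open>d + 2 - s\<close> points of a line \<open>L\<close>. If
  \<open>L \<noteq> R\<close>, then \<open>L\<close> contains at most one \<open>P\<^sub>i\<close>, and a form separating a point of \<open>S\<close> from
  the others can be corrected by a multiple of \<open>L\<close>, with a cofactor of degree \<open>d - 1\<close>, so as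
  to vanish on \<open>E\<close>. Conversely, \<open>d + 2\<close> points of \<open>R\<close> satisfy a linear relation against the
  \<open>d + 1\<close> binary monomials of degree \<open>d\<close>.
\<close>

section \<open>The Frobenius map of the quadratic field extension\<close>

locale hermitian_field =
  fixes q :: nat and ty :: "'a::{field,finite} itself"
  assumes q_prime_power: "prime_power q"
    and card_UNIV_field: "card (UNIV :: 'a set) = q ^ 2"
begin

lemma q_gt_1: "q > 1"
  using q_prime_power unfolding prime_power_def
  by (metis less_irrefl one_less_power prime_gt_1_nat)

text \<open>The link between \<open>q\<close> and the characteristic is what makes the
  \<open>q\<close>-th power additive, on the field as well as on its power series.\<close>

lemma char_power: "prime CHAR('a) \<and> (\<exists>k. q = CHAR('a) ^ k)"
proof -
  obtain p k where p: "prime p" "k > 0" "q = p ^ k"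
    using q_prime_power unfolding prime_power_def by blast
  have "prime CHAR('a)"
    by (intro prime_CHAR_semidom finite_imp_CHAR_pos) simp
  moreover have "CHAR('a) dvd p ^ (k * 2)"
  proof -
    \<comment> \<open>Translation by 1 permutes the field, so summing all elements in two ways shows
      that the number of elements is zero in the field.\<close>
    have "(\<Sum>x\<in>UNIV. x + 1 :: 'a) = (\<Sum>x\<in>UNIV. x)"
      by (rule sum.reindex_bij_witness[of _ "\<lambda>x. x - 1" "\<lambda>x. x + 1"]) auto
    then have "of_nat (card (UNIV :: 'a set)) = (0 :: 'a)"
      by (simp add: sum.distrib)
    then show ?thesis
      unfolding of_nat_eq_0_iff_char_dvd card_UNIV_field p power_mult .
  qed
  ultimately have "CHAR('a) = p"
    using p(1) by (meson prime_dvd_power primes_dvd_imp_eq)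
  with p show ?thesis by auto
qed

lemma frob_add: "(x + y :: 'a) ^ q = x ^ q + y ^ q"
  using char_power freshmans_dream' by metis

lemma frob_add_fps: "(x + y :: 'a fps) ^ q = x ^ q + y ^ q"
  using char_power freshmans_dream'[where ?'a = "'a fps"] by (metis semiring_char_fps)

lemma frob_minus: "(- x :: 'a) ^ q = - (x ^ q)"
  using frob_add[of x "- x"] q_gt_1 by (simp add: power_0_left add_eq_0_iff)

lemma frob_diff: "(x - y :: 'a) ^ q = x ^ q - y ^ q"
  using frob_add[of x "- y"] by (simp add: frob_minus)

text \<open>Frobenius is the conjugation of the quadratic extension. For nonzero \<open>x\<close>,
  multiplication by \<open>x\<close> permutes the nonzero elements; comparing the products gives
  \<open>x ^ (q^2 - 1) = 1\<close>.\<close>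

lemma frob_frob: "((x :: 'a) ^ q) ^ q = x"
proof (cases "x = 0")
  case True
  then show ?thesis using q_gt_1 by (simp add: power_0_left)
next
  case False
  have "x ^ card (UNIV - {0} :: 'a set) * \<Prod>(UNIV - {0}) = (\<Prod>y\<in>UNIV - {0}. x * y)"
    by (simp add: prod.distrib)
  also have "\<dots> = \<Prod>(UNIV - {0})"
    by (rule prod.reindex_bij_witness[of _ "\<lambda>y. y / x" "\<lambda>y. x * y"]) (use False in auto)
  finally have "x ^ card (UNIV - {0} :: 'a set) = 1"
    by (simp add: prod_zero_iff)
  then have "x ^ Suc (card (UNIV :: 'a set) - 1) = x"
    by (simp add: card_Diff_subset)
  then show ?thesis
    using card_UNIV_field q_gt_1 by (simp add: power2_eq_square flip: power_mult)
qed

lemma frob_eq_iff: "(x :: 'a) ^ q = y ^ q \<longleftrightarrow> x = y"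
  using frob_frob by metis

text \<open>A root count for a polynomial of degree \<open>q\<close>; \<open>e = 1\<close> bounds
  the trace fibres and \<open>e = -1\<close> the fixed field.\<close>

lemma card_frob_roots_le:
  fixes e c :: 'a
  shows "card {y. y ^ q + e * y = c} \<le> q"
proof -
  define p where "p = monom 1 q + [:- c, e:]"
  have deg: "degree p = q"
    unfolding p_def using q_gt_1
    by (subst degree_add_eq_left) (auto simp: degree_monom_eq intro: le_less_trans[of _ 1])
  then have "p \<noteq> 0" using q_gt_1 by auto
  then have "card {x. poly p x = 0} \<le> q"
    using card_poly_roots_bound[of p] deg by simp
  moreover have "{x. poly p x = 0} = {y. y ^ q + e * y = c}"
    by (auto simp: p_def poly_monom algebra_simps)
  ultimately show ?thesis by simp
qed

text \<open>Pigeonhole: the trace maps \<open>q ^ 2\<close> elements into the fixed field, which has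
  at most \<open>q\<close> elements, and every fibre has at most \<open>q\<close> elements. So both
  bounds are attained everywhere.\<close>

lemma card_trace_fibre:
  fixes c :: 'a
  assumes "c ^ q = c"
  shows "card {y. y ^ q + y = c} = q"
proof -
  define Fx where "Fx = {c::'a. c ^ q = c}"
  have "Fx = {y. y ^ q + (-1) * y = 0}"
    by (auto simp: Fx_def)
  then have cF: "card Fx \<le> q"
    using card_frob_roots_le[of "-1" 0] by simp
  have fibre: "card {y. y ^ q + y = b} \<le> q" for b :: 'a
    using card_frob_roots_le[of 1 b] by simp
  have sub: "y ^ q + y \<in> Fx" for y :: 'a
    by (simp add: Fx_def frob_add frob_frob add.commute)
  have "q ^ 2 = card (\<Union>b\<in>Fx. {y. y ^ q + y = b})"
  proof -
    have "(\<Union>b\<in>Fx. {y. y ^ q + y = b}) = UNIV"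
      using sub by auto
    then show ?thesis using card_UNIV_field by simp
  qed
  also have "\<dots> = (\<Sum>b\<in>Fx. card {y. y ^ q + y = b})"
    by (intro card_UN_disjoint) auto
  also have "\<dots> = card {y. y ^ q + y = c} + (\<Sum>b\<in>Fx - {c}. card {y. y ^ q + y = b})"
    using assms by (intro sum.remove) (auto simp: Fx_def)
  also have "(\<Sum>b\<in>Fx - {c}. card {y. y ^ q + y = b}) \<le> card (Fx - {c}) * q"
    using sum_bounded_above[of "Fx - {c}" "\<lambda>b. card {y. y ^ q + y = b}" q] fibre by simp
  also have "card (Fx - {c}) * q \<le> (q - 1) * q"
    using cF assms by (intro mult_right_mono) (auto simp: Fx_def card_Diff_subset)
  finally have "q ^ 2 \<le> card {y. y ^ q + y = c} + (q - 1) * q"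
    by simp
  moreover have "(q - 1) * q + q = q ^ 2"
    using q_gt_1 by (cases q) (auto simp: power2_eq_square)
  ultimately have "q \<le> card {y. y ^ q + y = c}"
    by linarith
  with fibre[of c] show ?thesis by simp
qed

lemma norm_in_fixed_field: "((x :: 'a) ^ (q + 1)) ^ q = x ^ (q + 1)"
  by (simp add: power_mult_distrib frob_frob)

end

section \<open>Frobenius on power series\<close>

lemma fps_X_power_dvd_iff:
  fixes f :: "'a::field fps"
  shows "fps_X ^ n dvd f \<longleftrightarrow> (\<forall>k<n. fps_nth f k = 0)"
proof (cases "f = 0")
  case False
  then show ?thesis
    by (auto simp: fps_dvd_iff intro: subdegree_geI nth_less_subdegree_zero)
qed auto

context hermitian_field
begin

text \<open>Split \<open>f\<close> into its constant term and a multiple of \<open>fps_X\<close>: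
  Frobenius is additive and turns the latter into a multiple of \<open>fps_X ^ q\<close>. This is
  the source of the contact order between curve and tangent.\<close>

lemma fps_X_power_dvd_frob_diff:
  fixes f :: "'a fps"
  shows "fps_X ^ q dvd f ^ q - fps_const (fps_nth f 0 ^ q)"
proof -
  have "f = fps_const (fps_nth f 0) + fps_X * fps_shift 1 f"
    by (rule fps_ext) (auto simp: fps_X_mult_nth)
  then have "f ^ q = fps_const (fps_nth f 0) ^ q + (fps_X * fps_shift 1 f) ^ q"
    using frob_add_fps by metis
  then show ?thesis
    by (simp add: fps_const_power power_mult_distrib)
qed

text \<open>Peeling off the constant coefficient and applying additivity of Frobenius moves the
  index from \<open>n\<close> to \<open>n - q\<close>.\<close>

lemma fps_nth_frob:
  fixes f :: "'a fps"
  shows "fps_nth (f ^ q) n = (if q dvd n then fps_nth f (n div q) ^ q else 0)"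
proof (induction n arbitrary: f rule: less_induct)
  case (less n)
  have "f = fps_const (fps_nth f 0) + fps_X * fps_shift 1 f"
    by (rule fps_ext) (auto simp: fps_X_mult_nth)
  then have "f ^ q = fps_const (fps_nth f 0) ^ q + (fps_X * fps_shift 1 f) ^ q"
    using frob_add_fps by metis
  then have *: "fps_nth (f ^ q) n = (if n = 0 then fps_nth f 0 ^ q else 0) +
      (if n < q then 0 else fps_nth (fps_shift 1 f ^ q) (n - q))"
    by (simp add: fps_const_power power_mult_distrib fps_X_power_mult_nth)
  show ?case
  proof (cases "n < q")
    case True
    then show ?thesis using * q_gt_1 by (auto simp: dvd_imp_le)
  next
    case False
    then have "n - q < n" using q_gt_1 by simp
    with * less.IH[of "n - q" "fps_shift 1 f"] False q_gt_1 show ?thesis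
      by (auto simp: le_div_geq dvd_minus_self)
  qed
qed

text \<open>The equation is a recursion for the coefficients: the one at \<open>n > 0\<close>
  involves, through \<open>f ^ q\<close>, only the one at \<open>n div q < n\<close>. The constant
  term is set to 0.\<close>

lemma ex_fps_artin_schreier:
  fixes g :: "'a fps"
  assumes "fps_nth g 0 = 0"
  shows "\<exists>f. fps_nth f 0 = 0 \<and> f + f ^ q = g"
proof -
  define T where "T \<equiv> \<lambda>(h::nat \<Rightarrow> 'a) n.
    if n = 0 then 0 else fps_nth g n - (if q dvd n then h (n div q) ^ q else 0)"
  define h where "h = wfrec less_than T"
  have "adm_wf less_than T"
    unfolding adm_wf_def T_def using q_gt_1 by auto
  then have h: "h n = T h n" for n
    unfolding h_def by (rule wfrec_fixpoint[OF wf_less_than, THEN fun_cong])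
  have h0: "h 0 = 0"
    by (subst h) (simp add: T_def)
  define f where "f = Abs_fps h"
  have "fps_nth (f + f ^ q) n = fps_nth g n" for n
  proof (cases "n = 0")
    case True
    then show ?thesis using assms h0 q_gt_1 by (simp add: f_def fps_nth_frob)
  next
    case False
    then have "h n = fps_nth g n - (if q dvd n then h (n div q) ^ q else 0)"
      by (subst h) (simp add: T_def)
    then show ?thesis by (simp add: f_def fps_nth_frob)
  qed
  then show ?thesis using h0 by (intro exI[of _ f]) (auto simp: f_def fps_eq_iff)
qed

end

section \<open>Forms as functions on triples of power series\<close>

fun dot3 :: "'a::comm_ring_1 pt3 \<Rightarrow> 'a pt3 \<Rightarrow> 'a" where
  "dot3 (a, b, c) (x, y, z) = a * x + b * y + c * z"

fun cross3 :: "'a::comm_ring_1 pt3 \<Rightarrow> 'a pt3 \<Rightarrow> 'a pt3" where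
  "cross3 (a, b, c) (x, y, z) = (b * z - c * y, c * x - a * z, a * y - b * x)"

fun smul3 :: "'a::comm_ring_1 \<Rightarrow> 'a pt3 \<Rightarrow> 'a pt3" where
  "smul3 k (x, y, z) = (k * x, k * y, k * z)"

fun add3 :: "'a::comm_ring_1 pt3 \<Rightarrow> 'a pt3 \<Rightarrow> 'a pt3" where
  "add3 (a, b, c) (x, y, z) = (a + x, b + y, c + z)"

fun const3 :: "'a::comm_ring_1 pt3 \<Rightarrow> 'a fps pt3" where
  "const3 (x, y, z) = (fps_const x, fps_const y, fps_const z)"

abbreviation lin :: "'a::field pt3 \<Rightarrow> 'a fps pt3 \<Rightarrow> 'a fps" where
  "lin l v \<equiv> dot3 (const3 l) v"

text \<open>Forms are treated as functions on triples of power series: this determines their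
  coefficients, and the values at rational points are recovered on constant series.\<close>

definition form :: "nat \<Rightarrow> (nat \<Rightarrow> nat \<Rightarrow> 'a::field) \<Rightarrow> 'a fps pt3 \<Rightarrow> 'a fps" where
  "form d c = (\<lambda>(X, Y, Z). form_eval_fps d c X Y Z)"

definition forms :: "nat \<Rightarrow> ('a::field fps pt3 \<Rightarrow> 'a fps) set" where
  "forms d = range (form d)"

lemma form_in_forms [simp]: "form d c \<in> forms d"
  by (simp add: forms_def)

lemma form_zero: "form d (\<lambda>_ _. 0) v = 0"
  by (cases v) (simp add: form_def form_eval_fps_def)

lemma form_add: "form d (\<lambda>i j. c i j + c' i j) v = form d c v + form d c' v"
  by (cases v) (simp add: form_def form_eval_fps_def sum.distrib algebra_simps flip: fps_const_add)

lemma form_diff: "form d (\<lambda>i j. c i j - c' i j) v = form d c v - form d c' v"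
  by (cases v) (simp add: form_def form_eval_fps_def sum_subtractf algebra_simps flip: fps_const_sub)

lemma form_scale: "form d (\<lambda>i j. k * c i j) v = fps_const k * form d c v"
  by (cases v) (simp add: form_def form_eval_fps_def sum_distrib_left mult.assoc flip: fps_const_mult)

lemma forms_0: "(\<lambda>v. 0) \<in> forms d"
  unfolding forms_def by (rule image_eqI[of _ _ "\<lambda>_ _. 0"]) (auto simp: form_zero)

lemma forms_add: "F \<in> forms d \<Longrightarrow> G \<in> forms d \<Longrightarrow> (\<lambda>v. F v + G v) \<in> forms d"
  unfolding forms_def image_iff by (metis (no_types, lifting) UNIV_I ext form_add)

lemma forms_scale: "F \<in> forms d \<Longrightarrow> (\<lambda>v. fps_const k * F v) \<in> forms d"
  unfolding forms_def image_iff by (metis (no_types, lifting) UNIV_I ext form_scale)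

lemma forms_sum: "(\<And>x. x \<in> A \<Longrightarrow> F x \<in> forms d) \<Longrightarrow> (\<lambda>v. \<Sum>x\<in>A. F x v) \<in> forms d"
  by (induction A rule: infinite_finite_induct) (auto simp: forms_0 forms_add)

lemma forms_monomial:
  assumes "i + j + k = d"
  shows "(\<lambda>(X, Y, Z). X ^ i * Y ^ j * Z ^ k) \<in> forms d"
proof -
  have "form d (\<lambda>i' j'. if i' = i then if j' = j then 1 else 0 else 0) (X, Y, Z) = X ^ i * Y ^ j * Z ^ k" for X Y Z :: "'a fps"
  proof -
    have *: "fps_const (if i' = i then if j' = j then 1 else 0 else 0) * X ^ i' * Y ^ j' * Z ^ (d - i' - j')
      = (if i' = i then if j' = j then X ^ i * Y ^ j * Z ^ k else 0 else 0)" for i' j'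
      using assms by auto
    have "form d (\<lambda>i' j'. if i' = i then if j' = j then 1 else 0 else 0) (X, Y, Z) =
      (\<Sum>i'\<le>d. if i' = i then \<Sum>j'\<le>d - i'. if j' = j then X ^ i * Y ^ j * Z ^ k else 0 else 0)"
      unfolding form_def form_eval_fps_def prod.case * by (intro sum.cong refl) simp
    also have "\<dots> = X ^ i * Y ^ j * Z ^ k"
      using assms by (auto simp: sum.delta)
    finally show ?thesis .
  qed
  then show ?thesis
    unfolding forms_def by (intro image_eqI[where x = "\<lambda>i' j'. if i' = i then if j' = j then 1 else 0 else 0"]) auto
qed

lemma forms_lin_mult:
  assumes "F \<in> forms d"
  shows "(\<lambda>v. lin l v * F v) \<in> forms (Suc d)"
proof -
  obtain c where F: "F = form d c" using assms by (auto simp: forms_def)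
  obtain l1 l2 l3 where l: "l = (l1, l2, l3)" by (cases l)
  define M :: "nat \<Rightarrow> nat \<Rightarrow> nat \<Rightarrow> 'a fps pt3 \<Rightarrow> 'a fps"
    where "M i j k = (\<lambda>(X, Y, Z). X ^ i * Y ^ j * Z ^ k)" for i j k
  have M: "i + j + k = Suc d \<Longrightarrow> M i j k \<in> forms (Suc d)" for i j k
    unfolding M_def by (rule forms_monomial)
  have "(\<lambda>v. \<Sum>i\<le>d. \<Sum>j\<le>d - i. fps_const (c i j) * (fps_const l1 * M (Suc i) j (d - i - j) v +
     (fps_const l2 * M i (Suc j) (d - i - j) v + fps_const l3 * M i j (Suc (d - i - j)) v))) \<in> forms (Suc d)"
    by (intro forms_sum forms_scale forms_add M) auto
  also have "(\<lambda>v. \<Sum>i\<le>d. \<Sum>j\<le>d - i. fps_const (c i j) * (fps_const l1 * M (Suc i) j (d - i - j) v +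
     (fps_const l2 * M i (Suc j) (d - i - j) v + fps_const l3 * M i j (Suc (d - i - j)) v))) =
     (\<lambda>v. lin l v * F v)"
    unfolding F l form_def form_eval_fps_def M_def
    by (rule ext) (auto simp: sum_distrib_left algebra_simps intro!: sum.cong)
  finally show ?thesis .
qed

lemma forms_const: "(\<lambda>v. fps_const k) \<in> forms 0"
  using forms_scale[OF forms_monomial[of 0 0 0 0], of k]
  by (simp add: case_prod_unfold)

lemma forms_prod_mult:
  assumes "F \<in> forms d" "finite A"
  shows "(\<lambda>v. (\<Prod>x\<in>A. lin (m x) v) * F v) \<in> forms (card A + d)"
  using assms(2) by (induction A rule: finite_induct)
    (use assms(1) in \<open>auto simp: mult.assoc intro: forms_lin_mult\<close>)

lemma forms_power_mult:
  assumes "F \<in> forms d"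
  shows "(\<lambda>v. lin m v ^ k * F v) \<in> forms (k + d)"
  using assms by (induction k) (auto simp: mult.assoc intro: forms_lin_mult)

text \<open>The scalar is an arbitrary power series, as needed for rescaling a germ by a
  unit.\<close>

lemma forms_homogeneous:
  assumes "F \<in> forms d"
  shows "F (smul3 k v) = k ^ d * F v"
proof -
  have *: "(k * X) ^ i * (k * Y) ^ j * (k * Z) ^ (d - i - j) = k ^ d * (X ^ i * Y ^ j * Z ^ (d - i - j))"
    if "i \<le> d" "j \<le> d - i" for i j and X Y Z :: "'a fps"
  proof -
    have "k ^ d = k ^ i * k ^ j * k ^ (d - i - j)"
      using that by (simp flip: power_add)
    then show ?thesis by (simp add: power_mult_distrib algebra_simps)
  qed
  obtain c where F: "F = form d c" using assms by (auto simp: forms_def)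
  obtain X Y Z where v: "v = (X, Y, Z)" by (cases v)
  have "fps_const (c i j) * (k * X) ^ i * (k * Y) ^ j * (k * Z) ^ (d - i - j) =
      k ^ d * (fps_const (c i j) * X ^ i * Y ^ j * Z ^ (d - i - j))" if "i \<le> d" "j \<le> d - i" for i j
    by (simp only: mult.assoc *[OF that, of X Y Z, unfolded mult.assoc] mult.left_commute[of "k ^ d"])
  then show ?thesis
    unfolding F v form_def form_eval_fps_def smul3.simps prod.case sum_distrib_left
    by (intro sum.cong refl) auto
qed

text \<open>Substituting a series without constant term is a ring homomorphism that fixes constants;
  it serves to change the parameter of a germ.\<close>

lemma forms_compose:
  assumes "F \<in> forms d" "fps_nth \<psi> 0 = 0"
  shows "fps_compose (F (X, Y, Z)) \<psi> = F (fps_compose X \<psi>, fps_compose Y \<psi>, fps_compose Z \<psi>)"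
  using assms unfolding forms_def form_def form_eval_fps_def
  by (auto simp: fps_compose_sum_distrib fps_compose_mult_distrib fps_compose_power)

lemma dvd_mult_diff:
  fixes a b :: "'a::comm_ring_1"
  assumes "m dvd a - a'" "m dvd b - b'"
  shows "m dvd a * b - a' * b'"
proof -
  have "a * b - a' * b' = a * (b - b') + (a - a') * b'" by (simp add: algebra_simps)
  then show ?thesis using assms by simp
qed

lemma dvd_power_diff:
  fixes a b :: "'a::comm_ring_1"
  assumes "m dvd a - a'"
  shows "m dvd a ^ k - a' ^ k"
  by (induction k) (auto intro: dvd_mult_diff assms)

lemma dvd_sum_diff:
  fixes f :: "'b \<Rightarrow> 'a::comm_ring_1"
  assumes "\<And>x. x \<in> A \<Longrightarrow> m dvd f x - g x"
  shows "m dvd sum f A - sum g A"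
  using assms by (simp flip: sum_subtractf add: dvd_sum)

text \<open>Applied with \<open>m\<close> a power of \<open>fps_X\<close>, this allows a germ to be
  replaced by its approximation on the tangent line.\<close>

lemma forms_cong:
  assumes "F \<in> forms d" "m dvd X - X'" "m dvd Y - Y'" "m dvd Z - Z'"
  shows "m dvd F (X, Y, Z) - F (X', Y', Z')"
  using assms unfolding forms_def form_def form_eval_fps_def
  by (auto intro!: dvd_sum_diff dvd_mult_diff dvd_power_diff)

lemma fps_const_sum: "fps_const (sum f A) = (\<Sum>x\<in>A. fps_const (f x))"
  by (induction A rule: infinite_finite_induct) (auto simp flip: fps_const_add)

lemma form_const3: "form d c (const3 (x, y, z)) = fps_const (form_eval d c x y z)"
  by (simp add: form_def form_eval_fps_def form_eval_def fps_const_power fps_const_sum)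

lemma lin_const3: "lin l (const3 v) = fps_const (dot3 l v)"
  by (cases l; cases v) simp

section \<open>Points, lines and tangents\<close>

lemma dot3_cross3_left [simp]: "dot3 (cross3 u v) u = 0"
  and dot3_cross3_right [simp]: "dot3 (cross3 u v) v = 0"
  by (cases u; cases v; simp add: algebra_simps)+

lemma dot3_smul3 [simp]: "dot3 l (smul3 k v) = k * dot3 l v" "dot3 (smul3 k l) v = k * dot3 l v"
  by (cases l; cases v; simp add: algebra_simps)+

lemma dot3_add3 [simp]: "dot3 l (add3 u v) = dot3 l u + dot3 l v"
  by (cases l; cases u; cases v; simp add: algebra_simps)

lemma cross3_smul3_self [simp]: "cross3 v (smul3 k v) = (0, 0, 0)"
  by (cases v) (simp add: algebra_simps)

lemma cross3_eq_0_iff: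
  fixes u v :: "'a::field pt3"
  assumes "u \<noteq> (0, 0, 0)"
  shows "cross3 u v = (0, 0, 0) \<longleftrightarrow> (\<exists>k. v = smul3 k u)"
proof
  obtain a b c where u: "u = (a, b, c)" by (cases u)
  obtain x y z where v: "v = (x, y, z)" by (cases v)
  assume "cross3 u v = (0, 0, 0)"
  then have *: "b * z = c * y" "c * x = a * z" "a * y = b * x"
    by (auto simp: u v)
  consider "a \<noteq> 0" | "b \<noteq> 0" | "c \<noteq> 0" using assms u by auto
  then show "\<exists>k. v = smul3 k u"
  proof cases
    case 1
    with * show ?thesis by (intro exI[of _ "x / a"]) (auto simp: u v field_simps)
  next
    case 2
    with * show ?thesis by (intro exI[of _ "y / b"]) (auto simp: u v field_simps)
  next
    case 3
    with * show ?thesis by (intro exI[of _ "z / c"]) (auto simp: u v field_simps)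
  qed
qed auto

text \<open>The form is the line joining \<open>u\<close> to a suitable \<open>e\<close>: by the
  scalar triple product its value at \<open>v\<close> is \<open>dot3 e (cross3 u v)\<close>, which
  is nonzero for some \<open>e\<close>.\<close>

lemma ex_separating_form:
  fixes u v :: "'a::field pt3"
  assumes "cross3 u v \<noteq> (0, 0, 0)"
  shows "\<exists>l. dot3 l u = 0 \<and> dot3 l v \<noteq> 0"
proof -
  obtain a b c where "cross3 u v = (a, b, c)" by (cases "cross3 u v")
  then have abc: "dot3 e (cross3 u v) = dot3 e (a, b, c)" for e by simp
  have "\<exists>e. dot3 e (cross3 u v) \<noteq> 0"
  proof (rule ccontr)
    assume "\<not> ?thesis"
    then have "dot3 (1, 0, 0) (a, b, c) = 0" "dot3 (0, 1, 0) (a, b, c) = 0" "dot3 (0, 0, 1) (a, b, c) = 0"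
      using abc by metis+
    then show False using assms \<open>cross3 u v = (a, b, c)\<close> by simp
  qed
  then obtain e where "dot3 e (cross3 u v) \<noteq> 0" by blast
  moreover have "dot3 e (cross3 u v) = dot3 (cross3 e u) v"
    by (cases e; cases u; cases v; simp add: algebra_simps)
  ultimately show ?thesis by (intro exI[of _ "cross3 e u"]) auto
qed

text \<open>Two distinct points span a unique line; the vector triple product identity expresses
  \<open>cross3 (cross3 u v) l\<close> through the two vanishing values.\<close>

lemma orthogonal_imp_multiple_of_cross3:
  fixes u v :: "'a::field pt3"
  assumes "cross3 u v \<noteq> (0, 0, 0)" "dot3 l u = 0" "dot3 l v = 0"
  shows "\<exists>k. l = smul3 k (cross3 u v)"
proof -
  have "cross3 (cross3 u v) l = (0, 0, 0)"
  proof -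
    have "cross3 (cross3 u v) l = add3 (smul3 (dot3 l u) v) (smul3 (- dot3 l v) u)"
      by (cases l; cases u; cases v; simp add: algebra_simps)
    then show ?thesis using assms by (cases u; cases v) simp
  qed
  then show ?thesis using cross3_eq_0_iff assms(1) by blast
qed

lemma proj_class_eq: "proj_class v = {smul3 c v | c. c \<noteq> 0}"
  unfolding proj_class_def by (cases v) simp

lemma in_proj_class_self [simp]: "v \<in> proj_class v"
  unfolding proj_class_eq by (cases v) (auto intro!: exI[of _ 1])

lemma in_proj_planeD:
  assumes "P \<in> proj_plane" "w \<in> P"
  shows "w \<noteq> (0, 0, 0)" "P = proj_class w"
proof -
  obtain v c where v: "P = proj_class v" "v \<noteq> (0, 0, 0)" and c: "c \<noteq> 0" "w = smul3 c v"
    using assms unfolding proj_plane_def by (auto simp: proj_class_eq)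
  show "w \<noteq> (0, 0, 0)" using v c by (cases v) auto
  have 1: "smul3 e v = smul3 (e / c) w" for e
    using c by (cases v) auto
  have 2: "smul3 e w = smul3 (e * c) v" for e
    using c by (cases v) auto
  show "P = proj_class w"
  proof (intro set_eqI iffI)
    fix x assume "x \<in> P"
    then obtain e where "e \<noteq> 0" "x = smul3 e v" using v(1) by (auto simp: proj_class_eq)
    with 1[of e] c(1) show "x \<in> proj_class w"
      unfolding proj_class_eq by (intro CollectI exI[of _ "e / c"]) auto
  next
    fix x assume "x \<in> proj_class w"
    then obtain e where "e \<noteq> 0" "x = smul3 e w" by (auto simp: proj_class_eq)
    with 2[of e] c(1) show "x \<in> P"
      unfolding v(1) proj_class_eq by (intro CollectI exI[of _ "e * c"]) auto
  qed
qed

lemma proj_plane_nonempty: "P \<in> proj_plane \<Longrightarrow> \<exists>w. w \<in> P"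
  unfolding proj_plane_def using in_proj_class_self by blast

lemma proj_eq_iff_cross3:
  assumes "P \<in> proj_plane" "u \<in> P" "Q \<in> proj_plane" "v \<in> Q"
  shows "P = Q \<longleftrightarrow> cross3 u v = (0, 0, 0)"
proof -
  note P = in_proj_planeD[OF assms(1,2)] and Q = in_proj_planeD[OF assms(3,4)]
  have "P = Q \<longleftrightarrow> (\<exists>k. v = smul3 k u)"
  proof
    assume "P = Q"
    then show "\<exists>k. v = smul3 k u" using assms(4) P(2) by (auto simp: proj_class_eq)
  next
    assume "\<exists>k. v = smul3 k u"
    then obtain k where k: "v = smul3 k u" by blast
    with Q(1) have "k \<noteq> 0" by (cases u) auto
    with k have "v \<in> P" using P(2) by (auto simp: proj_class_eq)
    then show "P = Q" using in_proj_planeD[OF assms(1)] Q(2) by simp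
  qed
  then show ?thesis using cross3_eq_0_iff[OF P(1)] by simp
qed

lemma in_proj_line_iff:
  assumes "P \<in> proj_plane" "u \<in> P"
  shows "P \<in> proj_line a b c \<longleftrightarrow> dot3 (a, b, c) u = 0"
proof -
  note P = in_proj_planeD[OF assms]
  have "(\<forall>(x, y, z)\<in>P. a * x + b * y + c * z = 0) \<longleftrightarrow> (\<forall>w\<in>P. dot3 (a, b, c) w = 0)"
    by auto
  also have "\<dots> \<longleftrightarrow> dot3 (a, b, c) u = 0"
  proof
    assume 0: "dot3 (a, b, c) u = 0"
    show "\<forall>w\<in>P. dot3 (a, b, c) w = 0"
    proof
      fix w assume "w \<in> P"
      then obtain k where "w = smul3 k u" using P(2) by (auto simp: proj_class_eq)
      then show "dot3 (a, b, c) w = 0" using 0 by (simp only: dot3_smul3 mult_zero_right)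
    qed
  qed (use assms(2) in blast)
  finally show ?thesis using assms(1) by (simp add: proj_line_def)
qed

fun herm3 :: "nat \<Rightarrow> 'a::comm_ring_1 pt3 \<Rightarrow> 'a" where
  "herm3 q (x, y, z) = herm_poly q x y z"

lemma herm3_smul3: "herm3 q (smul3 k v) = k ^ (q + 1) * herm3 q v"
  by (cases v) (simp add: herm_poly_def power_mult_distrib algebra_simps)

lemma in_herm_points_iff:
  assumes "P \<in> proj_plane" "u \<in> P"
  shows "P \<in> herm_points q \<longleftrightarrow> herm3 q u = 0"
proof -
  note P = in_proj_planeD[OF assms]
  have "(\<forall>(x, y, z)\<in>P. herm_poly q x y z = 0) \<longleftrightarrow> (\<forall>w\<in>P. herm3 q w = 0)"
    by auto
  also have "\<dots> \<longleftrightarrow> herm3 q u = 0"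
  proof
    assume 0: "herm3 q u = 0"
    show "\<forall>w\<in>P. herm3 q w = 0"
    proof
      fix w assume "w \<in> P"
      then obtain k where "w = smul3 k u" using P(2) by (auto simp: proj_class_eq)
      then show "herm3 q w = 0" using 0 by (simp only: herm3_smul3 mult_zero_right)
    qed
  qed (use assms(2) in blast)
  finally show ?thesis using assms(1) by (simp add: herm_points_def)
qed

lemma herm_points_in_plane: "P \<in> herm_points q \<Longrightarrow> P \<in> proj_plane"
  by (simp add: herm_points_def)

text \<open>The gradient of the Hermitian form in a field where \<open>q\<close> is zero;
  equivalently, the polar line of the point under the Hermitian polarity.\<close>

fun tangent_form :: "nat \<Rightarrow> 'a::comm_ring_1 pt3 \<Rightarrow> 'a pt3" where
  "tangent_form q (x, y, z) = (- (x ^ q), z ^ q, y ^ q)"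

lemma tangent_form_dot_self: "dot3 (tangent_form q p) p = herm3 q p"
  by (cases p) (simp add: herm_poly_def algebra_simps)

context hermitian_field
begin

text \<open>The conjugate symmetry of the Hermitian pairing, resting on Frobenius being an
  involution.\<close>

lemma tangent_form_dot_commute:
  fixes p w :: "'a pt3"
  shows "dot3 (tangent_form q w) p = dot3 (tangent_form q p) w ^ q"
  by (cases p; cases w) (simp add: frob_add frob_minus frob_diff power_mult_distrib frob_frob algebra_simps)

text \<open>A line contained in its own orthogonal would make the two tangent forms proportional,
  hence, undoing the Frobenius map, also the two points.\<close>
lemma tangent_form_nonzero:
  fixes P Q :: "'a pt3 set"
  assumes "P \<in> herm_points q" "p \<in> P" "Q \<in> herm_points q" "w \<in> Q" "P \<noteq> Q"
  shows "dot3 (tangent_form q p) w \<noteq> 0"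
proof
  assume 0: "dot3 (tangent_form q p) w = 0"
  note PP = herm_points_in_plane[OF assms(1)] and QP = herm_points_in_plane[OF assms(3)]
  have cr: "cross3 p w \<noteq> (0, 0, 0)"
    using assms proj_eq_iff_cross3[OF PP _ QP] by blast
  have p0: "p \<noteq> (0, 0, 0)" using in_proj_planeD PP assms by blast
  have "dot3 (tangent_form q p) p = 0" "dot3 (tangent_form q w) w = 0"
    using assms in_herm_points_iff[OF PP] in_herm_points_iff[OF QP]
    by (auto simp: tangent_form_dot_self)
  moreover have "dot3 (tangent_form q w) p = 0"
    using 0 q_gt_1 by (simp add: tangent_form_dot_commute[of w p] power_0_left)
  ultimately obtain k k' where k: "tangent_form q p = smul3 k (cross3 p w)"
      "tangent_form q w = smul3 k' (cross3 p w)"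
    using orthogonal_imp_multiple_of_cross3[OF cr] 0 by metis
  have "k \<noteq> 0"
    using k(1) p0 q_gt_1 by (cases p; cases w) auto
  then have tw: "tangent_form q w = smul3 (k' / k) (tangent_form q p)"
    unfolding k by (cases "cross3 p w") auto
  \<comment> \<open>The ratio of the two tangent forms needs a \<open>q\<close>-th root; as
    Frobenius is an involution, its \<open>q\<close>-th power is one.\<close>
  define n where "n = (k' / k) ^ q"
  have n: "n ^ q = k' / k" by (simp add: n_def frob_frob)
  obtain a b c where p: "p = (a, b, c)" by (cases p)
  obtain x y z where w: "w = (x, y, z)" by (cases w)
  have "x ^ q = (n * a) ^ q" "y ^ q = (n * b) ^ q" "z ^ q = (n * c) ^ q"
    using tw unfolding p w n[symmetric] by (auto simp: power_mult_distrib)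
  then have "w = smul3 n p"
    by (simp add: frob_eq_iff p w)
  then show False using cr by simp
qed

text \<open>For \<open>z = 0\<close> the equation forces \<open>x = 0\<close>, so (0:1:0) is the
  only point at infinity; any other point is normalised to \<open>z = 1\<close>.\<close>

lemma herm_point_cases:
  fixes P :: "'a pt3 set"
  assumes "P \<in> herm_points q"
  obtains (affine) x y where "(x, y, 1) \<in> P" "y ^ q + y = x ^ (q + 1)"
    | (infinity) "(0, 1, 0) \<in> P"
proof -
  note PP = herm_points_in_plane[OF assms]
  obtain x y z where w: "(x, y, z) \<in> P" using proj_plane_nonempty[OF PP] by auto
  have mult: "smul3 k (x, y, z) \<in> P" if "k \<noteq> 0" for k
    using in_proj_planeD(2)[OF PP w] that by (auto simp: proj_class_eq)
  have on: "herm3 q v = 0" if "v \<in> P" for v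
    using that assms in_herm_points_iff[OF PP] by blast
  show thesis
  proof (cases "z = 0")
    case True
    then have "x = 0" using on[OF w] q_gt_1 by (simp add: herm_poly_def power_0_left)
    moreover have "y \<noteq> 0" using in_proj_planeD(1)[OF PP w] True \<open>x = 0\<close> by simp
    ultimately show ?thesis using mult[of "1 / y"] True infinity by simp
  next
    case False
    then have *: "(x / z, y / z, 1) \<in> P" using mult[of "1 / z"] by simp
    then show ?thesis using affine[OF *] on[OF *] by (simp add: herm_poly_def algebra_simps)
  qed
qed

end

section \<open>The tangent line as a local model of the curve\<close>

definition tangent_curve :: "'a::field pt3 \<Rightarrow> 'a pt3 \<Rightarrow> 'a fps pt3" where
  "tangent_curve p v = add3 (const3 p) (smul3 fps_X (const3 v))"

lemma lin_tangent_curve: "lin l (tangent_curve p v) = fps_const (dot3 l p) + fps_X * fps_const (dot3 l v)"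
  by (simp add: tangent_curve_def lin_const3)

lemma fps_X_dvd_iff: "fps_X dvd f \<longleftrightarrow> fps_nth f 0 = 0" for f :: "'a::field fps"
  using fps_X_power_dvd_iff[of 1 f] by simp

lemma fps_X_power_dvd_compose:
  fixes f \<psi> :: "'a::field fps"
  assumes "fps_X ^ n dvd f" "fps_nth \<psi> 0 = 0"
  shows "fps_X ^ n dvd fps_compose f \<psi>"
proof -
  obtain g where "f = fps_X ^ n * g" using assms(1) by blast
  then have "fps_compose f \<psi> = \<psi> ^ n * fps_compose g \<psi>"
    using assms(2) by (simp add: fps_compose_mult_distrib flip: fps_compose_power)
  moreover have "fps_X dvd \<psi>" using assms(2) by (simp add: fps_X_dvd_iff)
  ultimately show ?thesis by (simp add: dvd_power_same dvd_mult2)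
qed

context hermitian_field
begin

text \<open>Modulo \<open>fps_X ^ q\<close> the \<open>q\<close>-th powers in the curve equation are
  constants, and what remains is the tangent equation up to a nonzero scalar.\<close>

lemma germ_near_tangent:
  fixes P :: "'a pt3 set"
  assumes "P \<in> herm_points q" "p \<in> P" "herm_germ q P X Y Z"
  shows "fps_X ^ q dvd lin (tangent_form q p) (X, Y, Z)"
proof -
  let ?X0 = "fps_nth X 0" and ?Y0 = "fps_nth Y 0" and ?Z0 = "fps_nth Z 0"
  have "(?X0, ?Y0, ?Z0) \<in> P" and herm: "herm_poly q X Y Z = 0"
    using assms(3) by (auto simp: herm_germ_def)
  then obtain k where k: "k \<noteq> 0" "(?X0, ?Y0, ?Z0) = smul3 k p"
    using in_proj_planeD(2)[OF herm_points_in_plane[OF assms(1)] assms(2)]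
    by (auto simp: proj_class_eq)
  have "fps_X ^ q dvd (X ^ q - fps_const (?X0 ^ q)) * X - (Z ^ q - fps_const (?Z0 ^ q)) * Y
     - (Y ^ q - fps_const (?Y0 ^ q)) * Z"
    by (intro dvd_diff dvd_mult2 fps_X_power_dvd_frob_diff)
  also have "\<dots> = lin (tangent_form q (?X0, ?Y0, ?Z0)) (X, Y, Z) - herm_poly q X Y Z"
    by (simp add: herm_poly_def algebra_simps flip: fps_const_neg)
  also have "\<dots> = fps_const (k ^ q) * lin (tangent_form q p) (X, Y, Z)"
    unfolding herm k(2) by (cases p) (simp add: power_mult_distrib algebra_simps flip: fps_const_neg fps_const_mult)
  finally show ?thesis
    using k(1) by (simp add: dvd_mult_unit_iff')
qed

text \<open>Up to order \<open>q\<close> every germ lies on the tangent line, where it is a unit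
  multiple of a reparametrised \<open>tangent_curve\<close>; hence divisibility on the tangent curve
  passes to all germs. The single germ with coordinates \<open>1\<close> and \<open>fps_X\<close>
  gives the other direction.\<close>

lemma vanishes_iff_tangent_curve:
  fixes P :: "'a pt3 set"
  assumes P: "P \<in> herm_points q" "p \<in> P"
    and frame: "\<And>\<gamma>. \<gamma> = add3 (add3 (smul3 (lin \<xi> \<gamma>) (const3 p)) (smul3 (lin \<eta> \<gamma>) (const3 v)))
       (smul3 (lin (tangent_form q p) \<gamma>) (const3 u))"
    and \<xi>: "dot3 \<xi> p = 1" and \<eta>: "dot3 \<eta> p = 0"
    and germ: "herm_germ q P X0 Y0 Z0" "lin \<xi> (X0, Y0, Z0) = 1" "lin \<eta> (X0, Y0, Z0) = fps_X"
    and a: "a \<le> q"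
  shows "vanishes_on_multpoint q d c P a \<longleftrightarrow> fps_X ^ a dvd form d c (tangent_curve p v)"
proof -
  let ?F = "form d c"
  \<comment> \<open>Dropping the component along \<open>u\<close>, which is the value of the tangent
    form, changes the form only by a multiple of \<open>fps_X ^ a\<close>.\<close>
  have near: "fps_X ^ a dvd ?F (X, Y, Z) - ?F (add3 (smul3 (lin \<xi> (X, Y, Z)) (const3 p)) (smul3 (lin \<eta> (X, Y, Z)) (const3 v)))"
    if g: "herm_germ q P X Y Z" for X Y Z
  proof -
    obtain X' Y' Z' where X': "add3 (smul3 (lin \<xi> (X, Y, Z)) (const3 p)) (smul3 (lin \<eta> (X, Y, Z)) (const3 v)) = (X', Y', Z')"
      by (cases "add3 (smul3 (lin \<xi> (X, Y, Z)) (const3 p)) (smul3 (lin \<eta> (X, Y, Z)) (const3 v))")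
    obtain u1 u2 u3 where u: "u = (u1, u2, u3)" by (cases u)
    define e where "e = lin (tangent_form q p) (X, Y, Z)"
    have e: "fps_X ^ a dvd e"
      unfolding e_def using germ_near_tangent[OF P g] a by (meson dvd_trans le_imp_power_dvd)
    have "(X, Y, Z) = add3 (X', Y', Z') (smul3 e (const3 u))"
      using frame[of "(X, Y, Z)"] unfolding X' e_def .
    then have "X - X' = e * fps_const u1" "Y - Y' = e * fps_const u2" "Z - Z' = e * fps_const u3"
      by (auto simp: u)
    then show ?thesis
      unfolding X' using e by (intro forms_cong[of _ d]) auto
  qed
  show ?thesis
  proof
    assume "vanishes_on_multpoint q d c P a"
    then have "fps_X ^ a dvd ?F (X0, Y0, Z0)"
      using germ(1) unfolding vanishes_on_multpoint_def fps_X_power_dvd_iff form_def by auto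
    moreover have "add3 (smul3 (lin \<xi> (X0, Y0, Z0)) (const3 p)) (smul3 (lin \<eta> (X0, Y0, Z0)) (const3 v)) = tangent_curve p v"
      unfolding germ(2,3) tangent_curve_def by (cases p; cases v) simp
    ultimately show "fps_X ^ a dvd ?F (tangent_curve p v)"
      using near[OF germ(1)] by (metis dvd_diff_right_iff)
  next
    assume dvd: "fps_X ^ a dvd ?F (tangent_curve p v)"
    have "fps_X ^ a dvd ?F (X, Y, Z)" if g: "herm_germ q P X Y Z" for X Y Z
    proof -
      define \<alpha> where "\<alpha> = lin \<xi> (X, Y, Z)"
      define \<beta> where "\<beta> = lin \<eta> (X, Y, Z)"
      have lin0: "fps_nth (lin l (X, Y, Z)) 0 = dot3 l (fps_nth X 0, fps_nth Y 0, fps_nth Z 0)" for l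
        by (cases l) simp
      obtain k where k: "k \<noteq> 0" "(fps_nth X 0, fps_nth Y 0, fps_nth Z 0) = smul3 k p"
        using g in_proj_planeD(2)[OF herm_points_in_plane[OF P(1)] P(2)]
        by (auto simp: proj_class_eq herm_germ_def)
      have \<alpha>0: "fps_nth \<alpha> 0 = k" and \<beta>0: "fps_nth \<beta> 0 = 0"
        unfolding \<alpha>_def \<beta>_def lin0 k(2) by (simp_all add: \<xi> \<eta>)
      \<comment> \<open>The tangential part \<open>\<alpha> p + \<beta> v\<close> equals
        \<open>\<alpha> (p + \<psi> v)\<close>: the unit \<open>\<alpha>\<close> comes out by
        homogeneity, and \<open>\<psi>\<close> is the new parameter.\<close>
      define \<psi> where "\<psi> = \<beta> * inverse \<alpha>"
      have \<psi>0: "fps_nth \<psi> 0 = 0" using \<beta>0 by (simp add: \<psi>_def)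
      have \<alpha>\<psi>: "\<alpha> * \<psi> = \<beta>"
        using \<alpha>0 k(1) inverse_mult_eq_1'[of \<alpha>] by (simp add: \<psi>_def algebra_simps)
      have "add3 (smul3 \<alpha> (const3 p)) (smul3 \<beta> (const3 v)) = smul3 \<alpha> (add3 (const3 p) (smul3 \<psi> (const3 v)))"
        unfolding \<alpha>\<psi>[symmetric] by (cases p; cases v) (simp add: algebra_simps)
      moreover have "?F (add3 (const3 p) (smul3 \<psi> (const3 v))) = fps_compose (?F (tangent_curve p v)) \<psi>"
        using \<psi>0 unfolding tangent_curve_def
        by (cases p; cases v) (simp add: forms_compose[of _ d] fps_compose_add_distrib fps_compose_mult_distrib)
      ultimately have "?F (add3 (smul3 \<alpha> (const3 p)) (smul3 \<beta> (const3 v))) = \<alpha> ^ d * fps_compose (?F (tangent_curve p v)) \<psi>"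
        by (simp add: forms_homogeneous[of _ d])
      then have "fps_X ^ a dvd ?F (add3 (smul3 \<alpha> (const3 p)) (smul3 \<beta> (const3 v)))"
        using fps_X_power_dvd_compose[OF dvd \<psi>0] by simp
      then show ?thesis using near[OF g] unfolding \<alpha>_def \<beta>_def by (metis dvd_diff_left_iff)
    qed
    then show "vanishes_on_multpoint q d c P a"
      unfolding vanishes_on_multpoint_def fps_X_power_dvd_iff form_def by auto
  qed
qed

end

section \<open>Germs and tangent frames at the rational points\<close>

context hermitian_field
begin

lemma herm_germ_affine:
  fixes P :: "'a pt3 set"
  assumes "(x, y, 1) \<in> P" "y ^ q + y = x ^ (q + 1)"
  shows "\<exists>Y. herm_germ q P (fps_const x + fps_X) Y 1"
proof -
  \<comment> \<open>This is \<open>(x + X)^(q+1) - x^(q+1)\<close>. Once the equation of the point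
    is subtracted, the increment \<open>f\<close> of \<open>y\<close> has to satisfy
    \<open>f + f ^ q = g\<close>.\<close>
  define g :: "'a fps" where
    "g = fps_const (x ^ q) * fps_X + fps_const x * fps_X ^ q + fps_X ^ (q + 1)"
  have "fps_nth g 0 = 0" using q_gt_1 by (simp add: g_def power_0_left fps_nth_power_0)
  then obtain f where f: "fps_nth f 0 = 0" "f + f ^ q = g"
    using ex_fps_artin_schreier by blast
  have cq: "(fps_const b + h) ^ q = fps_const (b ^ q) + h ^ q" for b :: 'a and h
    by (simp add: frob_add_fps fps_const_power)
  have "herm_poly q (fps_const x + fps_X) (fps_const y + f) 1 =
      fps_const y + fps_const (y ^ q) + (f + f ^ q) - (fps_const (x ^ q) + fps_X ^ q) * (fps_const x + fps_X)"
    unfolding herm_poly_def power_add power_one_right cq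
    by (simp add: algebra_simps flip: fps_const_add fps_const_sub fps_const_mult)
  also have "\<dots> = fps_const (y ^ q + y - x ^ (q + 1))"
    unfolding f(2) g_def by (simp add: algebra_simps flip: fps_const_add fps_const_sub fps_const_mult)
  also have "\<dots> = 0" using assms(2) by simp
  finally show ?thesis
    using assms(1) f(1) unfolding herm_germ_def by (intro exI[of _ "fps_const y + f"]) auto
qed

text \<open>In the chart \<open>y = 1\<close> the curve reads \<open>z + z^q = x^(q+1)\<close>,
  again an Artin-Schreier equation with \<open>x\<close> as parameter.\<close>

lemma herm_germ_infinity:
  fixes P :: "'a pt3 set"
  assumes "(0, 1, 0) \<in> P"
  shows "\<exists>Z. herm_germ q P fps_X 1 Z"
proof -
  have "fps_nth (fps_X ^ (q + 1) :: 'a fps) 0 = 0" by simp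
  then obtain f :: "'a fps" where f: "fps_nth f 0 = 0" "f + f ^ q = fps_X ^ (q + 1)"
    using ex_fps_artin_schreier by blast
  have "herm_poly q fps_X 1 f = (f + f ^ q) - fps_X ^ (q + 1)"
    by (simp add: herm_poly_def)
  then have "herm_poly q fps_X 1 f = 0" using f(2) by simp
  then show ?thesis
    using assms(1) f(1) unfolding herm_germ_def by (intro exI[of _ f]) auto
qed

text \<open>In either chart the point \<open>p\<close>, a tangent direction \<open>v\<close> and a
  third vector off the tangent form a basis whose dual basis is \<open>\<xi>\<close>,
  \<open>\<eta>\<close> and the tangent form.\<close>

lemma ex_tangent_frame:
  fixes P :: "'a pt3 set"
  assumes P: "P \<in> herm_points q"
  shows "\<exists>p v \<xi> \<eta>. p \<in> P \<and> dot3 \<xi> p = 1 \<and> dot3 \<xi> v = 0 \<and> dot3 \<eta> p = 0 \<and> dot3 \<eta> v = 1 \<and>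
    dot3 (tangent_form q p) v = 0 \<and>
    (\<forall>d c a. a \<le> q \<longrightarrow> vanishes_on_multpoint q d c P a = (fps_X ^ a dvd form d c (tangent_curve p v)))"
  using P
proof (cases rule: herm_point_cases)
  case (affine x y)
  \<comment> \<open>The tangent form at \<open>?p\<close> has coefficients
    \<open>(- x^q, 1, y^q)\<close>: it kills \<open>?v\<close> and takes the value 1 at the third
    basis vector \<open>(0, 1, 0)\<close>.\<close>
  let ?p = "(x, y, 1)" and ?v = "(1, x ^ q, 0)" and ?\<xi> = "(0, 0, 1)" and ?\<eta> = "(1, 0, - x)"
  obtain Y where germ: "herm_germ q P (fps_const x + fps_X) Y 1"
    using herm_germ_affine[OF affine] by blast
  have y: "fps_const y = fps_const (x ^ q) * fps_const x - fps_const (y ^ q)"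
  proof -
    have "y = x ^ q * x - y ^ q" using affine(2) by (simp add: eq_diff_eq algebra_simps)
    then show ?thesis by (metis fps_const_mult fps_const_sub)
  qed
  have frame: "\<gamma> = add3 (add3 (smul3 (lin ?\<xi> \<gamma>) (const3 ?p)) (smul3 (lin ?\<eta> \<gamma>) (const3 ?v)))
       (smul3 (lin (tangent_form q ?p) \<gamma>) (const3 (0, 1, 0)))" for \<gamma>
    by (cases \<gamma>) (simp add: y algebra_simps del: fps_const_mult fps_const_sub flip: fps_const_neg)
  have *: "vanishes_on_multpoint q d c P a = (fps_X ^ a dvd form d c (tangent_curve ?p ?v))" if "a \<le> q" for d c a
    by (rule vanishes_iff_tangent_curve[OF P affine(1) frame _ _ germ _ _ that])
       (auto simp: algebra_simps)
  show ?thesis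
    by (rule exI[of _ ?p], rule exI[of _ ?v], rule exI[of _ ?\<xi>], rule exI[of _ ?\<eta>])
       (use * affine in auto)
next
  case infinity
  let ?p = "(0, 1, 0) :: 'a pt3" and ?v = "(1, 0, 0) :: 'a pt3"
    and ?\<xi> = "(0, 1, 0) :: 'a pt3" and ?\<eta> = "(1, 0, 0) :: 'a pt3"
  obtain Z where germ: "herm_germ q P fps_X 1 Z"
    using herm_germ_infinity[OF infinity] by blast
  have frame: "\<gamma> = add3 (add3 (smul3 (lin ?\<xi> \<gamma>) (const3 ?p)) (smul3 (lin ?\<eta> \<gamma>) (const3 ?v)))
       (smul3 (lin (tangent_form q ?p) \<gamma>) (const3 (0, 0, 1)))" for \<gamma>
    using q_gt_1 by (cases \<gamma>) (simp add: power_0_left)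
  have *: "vanishes_on_multpoint q d c P a = (fps_X ^ a dvd form d c (tangent_curve ?p ?v))" if "a \<le> q" for d c a
    by (rule vanishes_iff_tangent_curve[OF P infinity(1) frame _ _ germ _ _ that]) auto
  show ?thesis
    by (rule exI[of _ ?p], rule exI[of _ ?v], rule exI[of _ ?\<xi>], rule exI[of _ ?\<eta>])
       (use * infinity q_gt_1 in \<open>auto simp: power_0_left\<close>)
qed

end

text \<open>Peel off one tangent line at a time: on the first line a form of degree \<open>e\<close> has
  \<open>e + 1\<close> free coefficients, and multiples of its equation do not disturb them.\<close>
lemma ex_form_with_jets:
  fixes \<gamma> :: "nat \<Rightarrow> 'a::field fps pt3"
  assumes "\<And>i. i < s \<Longrightarrow> lin (\<xi> i) (\<gamma> i) = 1" "\<And>i. i < s \<Longrightarrow> lin (\<eta> i) (\<gamma> i) = fps_X"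
    and "\<And>i. i < s \<Longrightarrow> lin (\<tau> i) (\<gamma> i) = 0"
    and "\<And>i j. i < s \<Longrightarrow> j < s \<Longrightarrow> i \<noteq> j \<Longrightarrow> fps_nth (lin (\<tau> i) (\<gamma> j)) 0 \<noteq> 0"
    and "\<And>i. i < s \<Longrightarrow> b i \<le> e + 1 - i" "s \<le> e + 1"
  shows "\<exists>F\<in>forms e. \<forall>i<s. fps_X ^ b i dvd F (\<gamma> i) - g i"
  using assms
proof (induction s arbitrary: e \<gamma> \<xi> \<eta> \<tau> b g)
  case 0
  then show ?case using forms_0 by auto
next
  case (Suc s)
  \<comment> \<open>On the first curve \<open>\<eta> 0\<close> becomes \<open>fps_X\<close> and
    \<open>\<xi> 0\<close> becomes 1, so \<open>F1\<close> restricts to the truncation of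
    \<open>g 0\<close> after degree \<open>e\<close>.\<close>
  define F1 where "F1 v = (\<Sum>k\<le>e. fps_const (fps_nth (g 0) k) * (lin (\<eta> 0) v ^ k * lin (\<xi> 0) v ^ (e - k)))" for v
  have F1: "F1 \<in> forms e"
    unfolding F1_def
  proof (intro forms_sum forms_scale)
    fix k assume "k \<in> {..e}"
    then show "(\<lambda>v. lin (\<eta> 0) v ^ k * lin (\<xi> 0) v ^ (e - k)) \<in> forms e"
      using forms_power_mult[OF forms_power_mult[OF forms_const[of 1]], of "\<eta> 0" k "\<xi> 0" "e - k"] by simp
  qed
  have F1_0: "fps_X ^ b 0 dvd F1 (\<gamma> 0) - g 0"
    unfolding fps_X_power_dvd_iff
  proof (intro allI impI)
    fix n assume "n < b 0"
    then have "n \<le> e" using Suc.prems(5)[of 0] by simp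
    have "fps_nth (F1 (\<gamma> 0)) n = (\<Sum>k\<le>e. if n = k then fps_nth (g 0) k else 0)"
      unfolding F1_def using Suc.prems(1,2)[of 0] by (simp add: fps_sum_nth fps_X_power_nth mult_delta_right)
    then show "fps_nth (F1 (\<gamma> 0) - g 0) n = 0" using \<open>n \<le> e\<close> by simp
  qed
  \<comment> \<open>With a single curve the degree may be 0, and no cofactor of degree
    \<open>e - 1\<close> is available or required.\<close>
  show ?case
  proof (cases "s = 0")
    case True
    then show ?thesis using F1 F1_0 by auto
  next
    case False
    then have e: "e \<ge> 1" using Suc.prems(6) by simp
    define h where "h i = lin (\<tau> 0) (\<gamma> (Suc i))" for i
    \<comment> \<open>On the other curves \<open>\<tau> 0\<close> is a unit, so the error left by
      \<open>F1\<close> can be divided by it and prescribed for a cofactor of degree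
      \<open>e - 1\<close>.\<close>
    have "\<exists>G\<in>forms (e - 1). \<forall>i<s. fps_X ^ b (Suc i) dvd G (\<gamma> (Suc i)) - (g (Suc i) - F1 (\<gamma> (Suc i))) * inverse (h i)"
    proof (rule Suc.IH[of "\<xi> \<circ> Suc" "\<gamma> \<circ> Suc" "\<eta> \<circ> Suc" "\<tau> \<circ> Suc" "b \<circ> Suc" "e - 1"
          "\<lambda>i. (g (Suc i) - F1 (\<gamma> (Suc i))) * inverse (h i)", unfolded comp_def])
      fix i assume "i < s"
      then show "b (Suc i) \<le> e - 1 + 1 - i" using Suc.prems(5)[of "Suc i"] e by simp
    qed (use Suc.prems e in auto)
    then obtain G where G: "G \<in> forms (e - 1)"
      "\<And>i. i < s \<Longrightarrow> fps_X ^ b (Suc i) dvd G (\<gamma> (Suc i)) - (g (Suc i) - F1 (\<gamma> (Suc i))) * inverse (h i)"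
      by blast
    define F where "F v = F1 v + lin (\<tau> 0) v * G v" for v
    have "F \<in> forms e"
      unfolding F_def using forms_add[OF F1] forms_lin_mult[OF G(1), of "\<tau> 0"] e by simp
    moreover have "fps_X ^ b i dvd F (\<gamma> i) - g i" if "i < Suc s" for i
    proof (cases i)
      case 0
      then show ?thesis using F1_0 Suc.prems(3)[of 0] by (simp add: F_def)
    next
      case (Suc j)
      then have j: "j < s" using that by simp
      have "inverse (h j) * h j = 1"
        unfolding h_def using Suc.prems(4)[of 0 "Suc j"] j by (intro inverse_mult_eq_1) simp
      then have "F (\<gamma> i) - g i = h j * (G (\<gamma> (Suc j)) - (g (Suc j) - F1 (\<gamma> (Suc j))) * inverse (h j))"
        by (simp add: F_def Suc h_def algebra_simps)
      then show ?thesis using G(2)[OF j] Suc by (simp add: dvd_mult)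
    qed
    ultimately show ?thesis by blast
  qed
qed

section \<open>Counting\<close>

lemma coeffs_eq_0_if_many_roots:
  fixes f :: "nat \<Rightarrow> 'a::idom"
  assumes "\<And>x. x \<in> S \<Longrightarrow> (\<Sum>i\<le>n. f i * x ^ i) = 0" "finite S" "card S > n" "i \<le> n"
  shows "f i = 0"
proof -
  define p where "p = (\<Sum>i\<le>n. monom (f i) i)"
  have poly: "poly p x = (\<Sum>i\<le>n. f i * x ^ i)" for x
    by (simp add: p_def poly_sum poly_monom)
  have "degree p \<le> n"
    unfolding p_def by (intro degree_sum_le) (auto intro: degree_monom_le[THEN order_trans])
  have "p = 0"
  proof (rule ccontr)
    assume "p \<noteq> 0"
    then have "card S \<le> card {x. poly p x = 0}"
      using assms(1) poly by (intro card_mono poly_roots_finite) auto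
    then show False
      using card_poly_roots_bound[OF \<open>p \<noteq> 0\<close>] \<open>degree p \<le> n\<close> assms(3) by linarith
  qed
  moreover have "coeff p i = f i"
    using assms(4) by (simp add: p_def coeff_sum coeff_monom)
  ultimately show ?thesis by simp
qed

lemma card_supported_functions:
  fixes A :: "'b set"
  assumes "finite A"
  shows "card {f :: 'b \<Rightarrow> 'a::{zero,finite}. \<forall>x. x \<notin> A \<longrightarrow> f x = 0} = card (UNIV :: 'a set) ^ card A"
proof -
  have "bij_betw (\<lambda>f. restrict f A) {f :: 'b \<Rightarrow> 'a. \<forall>x. x \<notin> A \<longrightarrow> f x = 0} (A \<rightarrow>\<^sub>E UNIV)"
    by (rule bij_betwI[where g = "\<lambda>f x. if x \<in> A then f x else 0"])
       (auto simp: fun_eq_iff restrict_def extensional_def PiE_def)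
  then show ?thesis
    using card_PiE[OF assms, of "\<lambda>_. UNIV :: 'a set"] by (simp add: bij_betw_same_card)
qed

text \<open>Infinite sets have \<open>card\<close> 0, so a positive cardinality certifies
  finiteness.\<close>

lemma finite_supported_functions:
  fixes A :: "'b set"
  assumes "finite A"
  shows "finite {f :: 'b \<Rightarrow> 'a::{zero,finite}. \<forall>x. x \<notin> A \<longrightarrow> f x = 0}"
  using card_supported_functions[OF assms, where ?'a = 'a]
  by (metis (no_types, lifting) card.infinite finite_UNIV finite_UNIV_card_ge_0 less_irrefl zero_less_power)

text \<open>Rank-nullity in counting form: every fibre over the image is a translate of the
  kernel.\<close>

lemma card_eq_card_image_times_card_kernel:
  fixes f :: "'v::ab_group_add \<Rightarrow> 'w::ab_group_add"
  assumes "finite V" and closed: "\<And>x y. x \<in> V \<Longrightarrow> y \<in> V \<Longrightarrow> x + y \<in> V" "\<And>x y. x \<in> V \<Longrightarrow> y \<in> V \<Longrightarrow> x - y \<in> V"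
    and hom: "\<And>x y. x \<in> V \<Longrightarrow> y \<in> V \<Longrightarrow> f (x - y) = f x - f y"
  shows "card V = card (f ` V) * card {x \<in> V. f x = 0}"
proof -
  have "card {x \<in> V. f x = w} = card {x \<in> V. f x = 0}" if w: "w \<in> f ` V" for w
  proof -
    obtain v where v: "v \<in> V" "f v = w" using w by blast
    have *: "f (x + v) = f x + f v" if "x \<in> V" for x
      using hom[OF closed(1)[OF that v(1)] v(1)] by (simp add: algebra_simps)
    have "bij_betw (\<lambda>x. x - v) {x \<in> V. f x = w} {x \<in> V. f x = 0}"
      by (rule bij_betwI[where g = "\<lambda>x. x + v"]) (use v closed hom * in auto)
    then show ?thesis by (rule bij_betw_same_card)
  qed
  then have "(\<Sum>w\<in>f ` V. card {x \<in> V. f x = w}) = card (f ` V) * card {x \<in> V. f x = 0}"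
    by simp
  moreover have "(\<Sum>w\<in>f ` V. card {x \<in> V. f x = w}) = card (\<Union>w\<in>f ` V. {x \<in> V. f x = w})"
    using assms(1) by (intro card_UN_disjoint[symmetric]) auto
  moreover have "(\<Union>w\<in>f ` V. {x \<in> V. f x = w}) = V" by auto
  ultimately show ?thesis by simp
qed

section \<open>Dimension and linear relations by cardinality\<close>

interpretation fscale: vector_space "fscale :: 'a::field \<Rightarrow> ('p \<Rightarrow> 'a) \<Rightarrow> 'p \<Rightarrow> 'a"
  by standard (auto simp: fscale_def fun_eq_iff algebra_simps)

text \<open>Coordinates with respect to a basis \<open>B\<close> identify \<open>C\<close> with the
  functions supported on \<open>B\<close>, so over a finite field the cardinality determines the
  dimension.\<close>

lemma code_dim_eqI:
  fixes C :: "('p \<Rightarrow> 'a::{field,finite}) set"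
  assumes sub: "fscale.subspace C" and fin: "finite C" and card: "card C = card (UNIV :: 'a set) ^ k"
  shows "code_dim C = k"
proof -
  obtain B where B: "B \<subseteq> C" "fscale.independent B" "C \<subseteq> fscale.span B" "card B = fscale.dim C"
    by (rule fscale.basis_exists)
  have finB: "finite B" using B(1) fin finite_subset by blast
  have C: "C = fscale.span B"
    using B(1,3) sub fscale.span_minimal by blast
  define V where "V = {f :: ('p \<Rightarrow> 'a) \<Rightarrow> 'a. \<forall>x. x \<notin> B \<longrightarrow> f x = 0}"
  define L where "L f = (\<Sum>v\<in>B. fscale (f v) v)" for f
  have L_cong: "L f = L g" if "\<And>x. x \<in> B \<Longrightarrow> f x = g x" for f g
    using that by (simp add: L_def)
  have "L ` V = C"
  proof -
    have "L f \<in> L ` V" for f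
      by (rule image_eqI[of _ _ "\<lambda>x. if x \<in> B then f x else 0"]) (auto simp: V_def intro: L_cong)
    then show ?thesis
      unfolding C fscale.span_finite[OF finB] by (auto simp: L_def)
  qed
  moreover have "inj_on L V"
  proof (rule inj_onI)
    fix f g assume fg: "f \<in> V" "g \<in> V" "L f = L g"
    have "(\<Sum>v\<in>B. fscale (f v - g v) v) = L f - L g"
      by (simp add: L_def fscale.scale_left_diff_distrib sum_subtractf)
    then have 0: "(\<Sum>v\<in>B. fscale (f v - g v) v) = 0" using fg(3) by simp
    have eq: "f v = g v" if "v \<in> B" for v
    proof (rule ccontr)
      assume "f v \<noteq> g v"
      with that have "\<exists>v\<in>B. f v - g v \<noteq> 0" by auto
      with 0 have "fscale.dependent B"
        unfolding fscale.dependent_finite[OF finB] by (intro exI[of _ "\<lambda>v. f v - g v"] conjI)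
      with B(2) show False by simp
    qed
    show "f = g"
    proof
      fix v show "f v = g v" using eq fg(1,2) by (cases "v \<in> B") (auto simp: V_def)
    qed
  qed
  ultimately have "card C = card V"
    using card_image by blast
  then have "card (UNIV :: 'a set) ^ k = card (UNIV :: 'a set) ^ card B"
    using card card_supported_functions[OF finB, where ?'a = 'a] by (simp add: V_def)
  moreover have "card (UNIV :: 'a set) > 1"
    using card_mono[of UNIV "{0, 1 :: 'a}"] by simp
  ultimately have "k = card B" by simp
  then show ?thesis using B(4) by (simp add: code_dim_def)
qed

text \<open>Fewer equations than unknowns: the map to the \<open>n\<close> values cannot be
  injective by counting, and two words with equal image differ by a solution.\<close>

lemma ex_nonzero_annihilator:
  fixes m :: "nat \<Rightarrow> 't \<Rightarrow> 'a::{field,finite}"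
  assumes "finite T" "n < card T"
  shows "\<exists>w. (\<forall>x. x \<notin> T \<longrightarrow> w x = 0) \<and> w \<noteq> 0 \<and> (\<forall>k<n. (\<Sum>x\<in>T. w x * m k x) = 0)"
proof -
  define V where "V = {f :: 't \<Rightarrow> 'a. \<forall>x. x \<notin> T \<longrightarrow> f x = 0}"
  define W where "W = {f :: nat \<Rightarrow> 'a. \<forall>x. x \<notin> {..<n} \<longrightarrow> f x = 0}"
  define L where "L w = (\<lambda>k. if k < n then \<Sum>x\<in>T. w x * m k x else 0)" for w
  have "card (UNIV :: 'a set) > 1"
    using card_mono[of UNIV "{0, 1 :: 'a}"] by simp
  then have "card W < card V"
    unfolding V_def W_def using assms by (simp add: card_supported_functions del: lessThan_iff)
  moreover have "L ` V \<subseteq> W"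
    by (auto simp: L_def W_def)
  moreover have "finite W"
    unfolding W_def by (rule finite_supported_functions) simp
  ultimately have "\<not> inj_on L V"
    using card_inj_on_le by (metis not_le)
  then obtain f g where fg: "f \<in> V" "g \<in> V" "f \<noteq> g" "L f = L g"
    unfolding inj_on_def by blast
  have "(\<Sum>x\<in>T. (f - g) x * m k x) = 0" if "k < n" for k
    using fun_cong[OF fg(4), of k] that by (simp add: L_def algebra_simps sum_subtractf)
  then show ?thesis
    using fg(1-3) by (intro exI[of _ "f - g"]) (auto simp: V_def)
qed

section \<open>Rational points of the curve and of its secants\<close>

lemma proj_class_in_plane: "v \<noteq> (0, 0, 0) \<Longrightarrow> proj_class v \<in> proj_plane"
  unfolding proj_plane_def by blast

context hermitian_field
begin

lemma affine_in_plane: "proj_class (x, y, 1 :: 'a) \<in> proj_plane"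
  by (rule proj_class_in_plane) simp

lemma affine_in_herm_points_iff: "proj_class (x, y, 1 :: 'a) \<in> herm_points q \<longleftrightarrow> y ^ q + y = x ^ (q + 1)"
  using in_herm_points_iff[OF affine_in_plane in_proj_class_self]
  by (simp add: herm_poly_def algebra_simps)

lemma affine_class_eq_iff: "proj_class (x, y, 1 :: 'a) = proj_class (x', y', 1) \<longleftrightarrow> x = x' \<and> y = y'"
  using proj_eq_iff_cross3[OF affine_in_plane in_proj_class_self affine_in_plane in_proj_class_self]
  by auto

lemma card_affine_fibre: "card {y :: 'a. y ^ q + y = x ^ (q + 1)} = q"
  by (rule card_trace_fibre) (rule norm_in_fixed_field)

text \<open>There is one point at infinity, and each of the \<open>q ^ 2\<close> values of
  \<open>x\<close> carries a trace fibre of \<open>q\<close> values of \<open>y\<close>.\<close>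

lemma card_herm_points: "card (herm_points q :: 'a pt3 set set) = q ^ 3 + 1"
proof -
  define A where "A = (SIGMA x:(UNIV :: 'a set). {y. y ^ q + y = x ^ (q + 1)})"
  define f :: "'a \<times> 'a \<Rightarrow> 'a pt3 set" where "f = (\<lambda>(x, y). proj_class (x, y, 1))"
  have infp: "proj_class (0, 1, 0 :: 'a) \<in> proj_plane"
    by (rule proj_class_in_plane) simp
  have inf: "proj_class (0, 1, 0 :: 'a) \<in> herm_points q"
    using in_herm_points_iff[OF infp in_proj_class_self] q_gt_1 by (simp add: herm_poly_def power_0_left)
  have "herm_points q = insert (proj_class (0, 1, 0)) (f ` A)"
  proof (intro set_eqI iffI)
    fix P :: "'a pt3 set" assume P: "P \<in> herm_points q"
    note PP = herm_points_in_plane[OF P]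
    from P show "P \<in> insert (proj_class (0, 1, 0)) (f ` A)"
    proof (cases rule: herm_point_cases)
      case (affine x y)
      then have "P = f (x, y)" using in_proj_planeD[OF PP] by (simp add: f_def)
      then show ?thesis using affine by (auto simp: A_def)
    next
      case infinity
      then show ?thesis using in_proj_planeD[OF PP] by simp
    qed
  next
    fix P assume "P \<in> insert (proj_class (0, 1, 0)) (f ` A)"
    then show "P \<in> herm_points q"
      using inf by (auto simp: f_def A_def affine_in_herm_points_iff)
  qed
  moreover have "proj_class (0, 1, 0) \<notin> f ` A"
    using proj_eq_iff_cross3[OF infp in_proj_class_self affine_in_plane in_proj_class_self]
    by (auto simp: f_def)
  moreover have "inj_on f A"
    by (auto simp: inj_on_def f_def affine_class_eq_iff)
  moreover have "card A = q ^ 3"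
  proof -
    have "card A = (\<Sum>x\<in>(UNIV :: 'a set). q)"
      unfolding A_def using card_affine_fibre by (subst card_SigmaI) auto
    then show ?thesis using card_UNIV_field by (simp add: power2_eq_square power3_eq_cube)
  qed
  ultimately show ?thesis by (simp add: card_image)
qed

text \<open>On the points \<open>u p1 + p2\<close> the Hermitian form becomes the trace of
  \<open>u * h\<close>, with \<open>h\<close> the nonzero pairing of the two points. It has
  \<open>q\<close> zeros, and \<open>P1\<close> itself is one more point.\<close>

lemma card_secant_ge:
  fixes P1 P2 :: "'a pt3 set"
  assumes P: "P1 \<in> herm_points q" "P2 \<in> herm_points q" "P1 \<noteq> P2"
    and R: "is_line R" "P1 \<in> R" "P2 \<in> R"
  shows "q + 1 \<le> card (R \<inter> herm_points q)"
proof -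
  note PP1 = herm_points_in_plane[OF P(1)] and PP2 = herm_points_in_plane[OF P(2)]
  obtain p1 p2 where p: "p1 \<in> P1" "p2 \<in> P2" using proj_plane_nonempty PP1 PP2 by blast
  have cr: "cross3 p1 p2 \<noteq> (0, 0, 0)" using proj_eq_iff_cross3[OF PP1 p(1) PP2 p(2)] P(3) by simp
  obtain a b c where abc: "R = proj_line a b c" using R(1) by (auto simp: is_line_def)
  have l: "dot3 (a, b, c) p1 = 0" "dot3 (a, b, c) p2 = 0"
    using R(2,3) in_proj_line_iff PP1 PP2 p unfolding abc by blast+
  have on: "herm3 q p1 = 0" "herm3 q p2 = 0"
    using P in_herm_points_iff PP1 PP2 p by blast+
  define h where "h = dot3 (tangent_form q p2) p1"
  have h0: "h \<noteq> 0" unfolding h_def using tangent_form_nonzero[OF P(2) p(2) P(1) p(1)] P(3) by simp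
  have herm: "herm3 q (add3 (smul3 u p1) p2) = (u * h) ^ q + u * h" for u
  proof -
    have "herm3 q (add3 (smul3 u p1) p2) = u ^ (q + 1) * herm3 q p1 + herm3 q p2 +
        u ^ q * dot3 (tangent_form q p1) p2 + u * dot3 (tangent_form q p2) p1"
      by (cases p1; cases p2) (simp add: herm_poly_def frob_add power_mult_distrib algebra_simps)
    then show ?thesis using on by (simp add: tangent_form_dot_commute[of p1 p2] h_def power_mult_distrib)
  qed
  define U where "U = {u. (u * h) ^ q + u * h = 0}"
  have "bij_betw (\<lambda>u. u * h) U {y. y ^ q + y = 0}"
    by (rule bij_betwI[where g = "\<lambda>y. y / h"]) (use h0 in \<open>auto simp: U_def\<close>)
  then have cU: "card U = q"
    using card_trace_fibre[of 0] q_gt_1 by (simp add: bij_betw_same_card power_0_left)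
  define f where "f u = proj_class (add3 (smul3 u p1) p2)" for u
  have crf: "cross3 (add3 (smul3 u p1) p2) (add3 (smul3 u' p1) p2) = smul3 (u - u') (cross3 p1 p2)" for u u'
    by (cases p1; cases p2) (simp add: algebra_simps)
  have crf1: "cross3 p1 (add3 (smul3 u p1) p2) = cross3 p1 p2" for u
    by (cases p1; cases p2) (simp add: algebra_simps)
  have pl: "f u \<in> proj_plane" for u
  proof -
    have "cross3 p1 (0, 0, 0) = (0, 0, 0)" by (cases p1) simp
    then have "add3 (smul3 u p1) p2 \<noteq> (0, 0, 0)" using crf1[of u] cr by metis
    then show ?thesis unfolding f_def by (rule proj_class_in_plane)
  qed
  have mem: "add3 (smul3 u p1) p2 \<in> f u" for u by (simp add: f_def)
  have "inj f"
  proof (rule injI)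
    fix u u' assume "f u = f u'"
    then have "smul3 (u - u') (cross3 p1 p2) = (0, 0, 0)"
      using proj_eq_iff_cross3[OF pl mem pl mem, of u u'] by (simp add: crf)
    then show "u = u'" using cr by (cases "cross3 p1 p2") auto
  qed
  moreover have "P1 \<notin> f ` U"
    using proj_eq_iff_cross3[OF PP1 p(1) pl mem] cr by (auto simp: crf1)
  ultimately have "card (insert P1 (f ` U)) = q + 1"
    using cU by (simp add: card_image inj_on_subset[of f UNIV])
  moreover have "insert P1 (f ` U) \<subseteq> R \<inter> herm_points q"
  proof -
    have "f u \<in> R" for u
      unfolding abc in_proj_line_iff[OF pl mem] using l by simp
    moreover have "f u \<in> herm_points q" if "u \<in> U" for u
      unfolding in_herm_points_iff[OF pl mem] herm using that by (simp add: U_def)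
    ultimately show ?thesis using P(1) R(2) by auto
  qed
  ultimately show ?thesis by (metis card_mono finite)
qed

end

section \<open>Values at rational points and injectivity of evaluation in low degree\<close>

definition form_value :: "('a::field fps pt3 \<Rightarrow> 'a fps) \<Rightarrow> 'a pt3 \<Rightarrow> 'a" where
  "form_value F w = fps_nth (F (const3 w)) 0"

lemma form_value_form: "form_value (form d c) (x, y, z) = form_eval d c x y z"
  unfolding form_value_def form_const3 by simp

lemma form_value_smul3: "F \<in> forms d \<Longrightarrow> form_value F (smul3 k w) = k ^ d * form_value F w"
proof -
  assume F: "F \<in> forms d"
  have "const3 (smul3 k w) = smul3 (fps_const k) (const3 w)" by (cases w) simp
  then show ?thesis unfolding form_value_def by (simp add: forms_homogeneous[OF F] fps_const_power)
qed

context hermitian_field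
begin

text \<open>Over an \<open>x\<close> whose fibre avoids \<open>A\<close> the form is a polynomial in
  \<open>y\<close> of degree at most \<open>d\<close> with \<open>q > d\<close> zeros. Its
  coefficients, polynomials in \<open>x\<close>, therefore vanish at all such \<open>x\<close>, and
  these number more than \<open>d\<close>.\<close>

lemma form_eq_0_if_vanishes_on_herm_points:
  fixes c :: "nat \<Rightarrow> nat \<Rightarrow> 'a"
  assumes supp: "\<And>i j. i + j > d \<Longrightarrow> c i j = 0"
    and d: "d < q" "finite A" "card A + d < q ^ 2"
    and zero: "\<And>Q. Q \<in> herm_points q - A \<Longrightarrow> \<exists>w\<in>Q. form_value (form d c) w = 0"
  shows "c i j = 0"
proof (cases "i + j \<le> d")
  case True
  define G where "G = {x :: 'a. \<forall>y. proj_class (x, y, 1) \<notin> A}"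
  have val: "form_value (form d c) (x, y, 1) = (\<Sum>j\<le>d. (\<Sum>i\<le>d. c i j * x ^ i) * y ^ j)" for x y
  proof -
    have "form_value (form d c) (x, y, 1) = (\<Sum>i\<le>d. \<Sum>j\<le>d. c i j * x ^ i * y ^ j)"
      unfolding form_value_form form_eval_def
      by (intro sum.cong refl sum.mono_neutral_cong_left) (auto simp: supp)
    also have "\<dots> = (\<Sum>j\<le>d. (\<Sum>i\<le>d. c i j * x ^ i) * y ^ j)"
      by (subst sum.swap) (simp add: sum_distrib_right)
    finally show ?thesis .
  qed
  have inner: "(\<Sum>i\<le>d. c i j * x ^ i) = 0" if x: "x \<in> G" for x
  proof (rule coeffs_eq_0_if_many_roots[where S = "{y. y ^ q + y = x ^ (q + 1)}" and n = d
        and f = "\<lambda>j. \<Sum>i\<le>d. c i j * x ^ i"])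
    fix y assume "y \<in> {y. y ^ q + y = x ^ (q + 1)}"
    then have "proj_class (x, y, 1) \<in> herm_points q - A"
      using x by (auto simp: G_def affine_in_herm_points_iff)
    from zero[OF this] obtain k where "k \<noteq> 0" "form_value (form d c) (smul3 k (x, y, 1)) = 0"
      unfolding proj_class_eq by blast
    then show "(\<Sum>j\<le>d. (\<Sum>i\<le>d. c i j * x ^ i) * y ^ j) = 0"
      using form_value_smul3[of "form d c" d k "(x, y, 1)"] val by simp
  qed (use True d in \<open>auto simp: card_affine_fibre[unfolded Suc_eq_plus1[symmetric], simplified]\<close>)
  \<comment> \<open>Each excluded \<open>x\<close> has a point of \<open>A\<close> above it, and
    different \<open>x\<close> give different points.\<close>
  have "card (- G) \<le> card A"
  proof -
    have "\<forall>x\<in>- G. \<exists>y. proj_class (x, y, 1) \<in> A" by (auto simp: G_def)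
    then obtain y where y: "\<forall>x\<in>- G. proj_class (x, y x, 1) \<in> A" by metis
    show ?thesis
      by (rule card_inj_on_le[where f = "\<lambda>x. proj_class (x, y x, 1)"])
         (use y d in \<open>auto simp: inj_on_def affine_class_eq_iff\<close>)
  qed
  moreover have "card G + card (- G) = q ^ 2"
    using card_UNIV_field card_Un_disjoint[of G "- G"] by (simp add: Compl_partition)
  ultimately have "card G > d" using d by linarith
  then show ?thesis
    using coeffs_eq_0_if_many_roots[where S = G and n = d and f = "\<lambda>i. c i j" and i = i] inner True by simp
qed (use supp in simp)

end

section \<open>Restriction of forms to points and lines\<close>

lemma form_value_mult: "form_value (\<lambda>v. F v * G v) w = form_value F w * form_value G w"
  by (simp add: form_value_def)

lemma form_value_add: "form_value (\<lambda>v. F v + G v) w = form_value F w + form_value G w"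
  by (simp add: form_value_def)

lemma form_value_lin: "form_value (lin l) w = dot3 l w"
  by (simp add: form_value_def lin_const3)

lemma fps_nth_prod_0: "fps_nth (\<Prod>x\<in>A. f x) 0 = (\<Prod>x\<in>A. fps_nth (f x) 0)"
  for f :: "'b \<Rightarrow> 'a::comm_ring_1 fps"
  by (induction A rule: infinite_finite_induct) auto

text \<open>The product of the lines in \<open>N\<close> is padded to degree \<open>e\<close> with
  powers of \<open>l0\<close>. Divisibility is stated on arbitrary curves so that it yields zeros at
  points as well as on tangent curves.\<close>

lemma ex_product_form:
  fixes N :: "'a::field pt3 set"
  assumes "finite N" "card N \<le> e" "\<And>l. l \<in> N \<Longrightarrow> dot3 l x \<noteq> 0" "dot3 l0 x \<noteq> 0"
  shows "\<exists>F\<in>forms e. form_value F x \<noteq> 0 \<and> (\<forall>\<gamma>. \<forall>l\<in>N. lin l \<gamma> dvd F \<gamma>)"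
proof -
  define F where "F v = (\<Prod>l\<in>N. lin l v) * lin l0 v ^ (e - card N)" for v
  have "(\<lambda>v. lin l0 v ^ (e - card N)) \<in> forms (e - card N)"
    using forms_power_mult[OF forms_const[of 1], of l0 "e - card N"] by simp
  then have "F \<in> forms e"
    unfolding F_def using forms_prod_mult[OF _ assms(1), of _ _ "\<lambda>l. l"] assms(2) by fastforce
  moreover have "form_value F x \<noteq> 0"
    using assms(3,4,1) by (simp add: form_value_def F_def lin_const3 fps_nth_prod_0 fps_nth_power_0)
  moreover have "lin l \<gamma> dvd F \<gamma>" if "l \<in> N" for l \<gamma>
    unfolding F_def using dvd_prodI[OF assms(1) that, of "\<lambda>l. lin l \<gamma>"] by (rule dvd_mult2)
  ultimately show ?thesis by blast
qed

lemma form_value_eq_0_if_lin_dvd: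
  assumes "\<And>\<gamma>. lin l \<gamma> dvd F \<gamma>" "dot3 l x = 0"
  shows "form_value F x = 0"
  using assms(1)[of "const3 x"] assms(2) by (simp add: lin_const3 form_value_def)

lemma form_value_tangent_curve:
  assumes "F \<in> forms d"
  shows "fps_nth (F (tangent_curve p v)) 0 = form_value F p"
proof -
  have "fps_X dvd F (tangent_curve p v) - F (const3 p)"
    unfolding tangent_curve_def
    by (cases p; cases v) (simp, intro forms_cong[OF assms]; simp)
  then show ?thesis by (simp add: fps_X_dvd_iff form_value_def)
qed

text \<open>On the line, \<open>cross3 x p2\<close> is parallel to \<open>cross3 p1 p2\<close>; the
  ratio is the coefficient of \<open>p1\<close>, and the remainder of \<open>x\<close> is parallel
  to \<open>p2\<close>.\<close>

lemma in_span_if_dot3_cross3_eq_0: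
  fixes p1 p2 x :: "'a::field pt3"
  assumes cr: "cross3 p1 p2 \<noteq> (0, 0, 0)" and x: "dot3 (cross3 p1 p2) x = 0"
  shows "\<exists>u t. x = add3 (smul3 u p1) (smul3 t p2)"
proof -
  have "cross3 (cross3 p1 p2) (cross3 x p2) =
      add3 (smul3 (dot3 (cross3 p1 p2) p2) x) (smul3 (- dot3 (cross3 p1 p2) x) p2)"
    by (cases p1; cases p2; cases x) (simp add: algebra_simps)
  also have "\<dots> = (0, 0, 0)" using x by (cases x; cases p2) simp
  finally obtain u where u: "cross3 x p2 = smul3 u (cross3 p1 p2)"
    using cross3_eq_0_iff[OF cr] by blast
  have "cross3 p2 (add3 x (smul3 (- u) p1)) = add3 (smul3 (- 1) (cross3 x p2)) (smul3 u (cross3 p1 p2))"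
    by (cases p1; cases p2; cases x) (simp add: algebra_simps)
  also have "\<dots> = (0, 0, 0)" unfolding u by (cases "cross3 p1 p2") simp
  finally have "cross3 p2 (add3 x (smul3 (- u) p1)) = (0, 0, 0)" .
  moreover have "p2 \<noteq> (0, 0, 0)" using cr by (cases p1) auto
  ultimately obtain t where "add3 x (smul3 (- u) p1) = smul3 t p2"
    using cross3_eq_0_iff by blast
  then have "x = add3 (smul3 u p1) (smul3 t p2)"
    by (cases p1; cases p2; cases x) (auto simp: algebra_simps)
  then show ?thesis by blast
qed

text \<open>Restriction to a line leaves only \<open>d + 1\<close> coefficients, one fewer than the
  \<open>d + 2\<close> points used later. Functions suffice because only values at points
  enter.\<close>

definition binary_forms :: "nat \<Rightarrow> ('a::field \<Rightarrow> 'a \<Rightarrow> 'a) set" where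
  "binary_forms d = {\<phi>. \<exists>f. \<forall>u t. \<phi> u t = (\<Sum>k\<le>d. f k * (u ^ (d - k) * t ^ k))}"

lemma binary_forms_add:
  assumes "\<phi> \<in> binary_forms d" "\<psi> \<in> binary_forms d"
  shows "(\<lambda>u t. \<phi> u t + \<psi> u t) \<in> binary_forms d"
proof -
  obtain f g where "\<forall>u t. \<phi> u t = (\<Sum>k\<le>d. f k * (u ^ (d - k) * t ^ k))"
      "\<forall>u t. \<psi> u t = (\<Sum>k\<le>d. g k * (u ^ (d - k) * t ^ k))"
    using assms unfolding binary_forms_def by blast
  then show ?thesis unfolding binary_forms_def
    by (intro CollectI exI[of _ "\<lambda>k. f k + g k"]) (simp add: sum.distrib distrib_right)
qed

lemma binary_forms_sum:
  "(\<And>x. x \<in> A \<Longrightarrow> \<phi> x \<in> binary_forms d) \<Longrightarrow> (\<lambda>u t. \<Sum>x\<in>A. \<phi> x u t) \<in> binary_forms d"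
proof (induction A rule: infinite_finite_induct)
  case (insert x A)
  then show ?case using binary_forms_add[of "\<phi> x" d "\<lambda>u t. \<Sum>x\<in>A. \<phi> x u t"] by simp
qed (auto simp: binary_forms_def intro: exI[of _ "\<lambda>_. 0"])

lemma binary_forms_lin_mult:
  assumes "\<phi> \<in> binary_forms d"
  shows "(\<lambda>u t. (u * \<alpha> + t * \<beta>) * \<phi> u t) \<in> binary_forms (Suc d)"
proof -
  obtain f where f: "\<And>u t. \<phi> u t = (\<Sum>k\<le>d. f k * (u ^ (d - k) * t ^ k))"
    using assms unfolding binary_forms_def by blast
  \<comment> \<open>Multiplication by \<open>u\<close> keeps the exponent of \<open>t\<close> and
    multiplication by \<open>t\<close> raises it by one; the value 0 fills the free end in either
    case.\<close>
  define g where "g k = (if k \<le> d then \<alpha> * f k else 0)" for k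
  define h where "h k = (if k = 0 then 0 else \<beta> * f (k - 1))" for k
  have "(\<Sum>k\<le>Suc d. g k * (u ^ (Suc d - k) * t ^ k)) = u * \<alpha> * \<phi> u t" for u t
    by (simp add: f g_def sum_distrib_left Suc_diff_le algebra_simps)
  moreover have "(\<Sum>k\<le>Suc d. h k * (u ^ (Suc d - k) * t ^ k)) = t * \<beta> * \<phi> u t" for u t
    unfolding sum.atMost_Suc_shift by (simp add: f h_def sum_distrib_left algebra_simps)
  ultimately show ?thesis unfolding binary_forms_def
    by (intro CollectI exI[of _ "\<lambda>k. g k + h k"] allI) (simp only: distrib_right sum.distrib)
qed

lemma binary_forms_power_mult:
  assumes "\<phi> \<in> binary_forms d"
  shows "(\<lambda>u t. (u * \<alpha> + t * \<beta>) ^ k * \<phi> u t) \<in> binary_forms (k + d)"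
proof (induction k)
  case (Suc k)
  then show ?case using binary_forms_lin_mult[OF Suc, of \<alpha> \<beta>] by (simp add: mult.assoc)
qed (use assms in simp)

lemma forms_restrict_to_line:
  assumes "F \<in> forms d"
  shows "(\<lambda>u t. form_value F (add3 (smul3 u p1) (smul3 t p2))) \<in> binary_forms d"
proof -
  obtain c where F: "F = form d c" using assms by (auto simp: forms_def)
  obtain a1 a2 a3 where p1: "p1 = (a1, a2, a3)" by (cases p1)
  obtain b1 b2 b3 where p2: "p2 = (b1, b2, b3)" by (cases p2)
  have "(\<lambda>u t. \<Sum>i\<le>d. \<Sum>j\<le>d - i. (u * a1 + t * b1) ^ i * ((u * a2 + t * b2) ^ j *
      ((u * a3 + t * b3) ^ (d - i - j) * c i j))) \<in> binary_forms d"
  proof (intro binary_forms_sum)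
    fix i j assume ij: "i \<in> {..d}" "j \<in> {..d - i}"
    have "(\<lambda>u t. c i j) \<in> binary_forms 0"
      unfolding binary_forms_def by (auto intro: exI[of _ "\<lambda>_. c i j"])
    from binary_forms_power_mult[OF binary_forms_power_mult[OF binary_forms_power_mult[OF this,
          of a3 b3 "d - i - j"], of a2 b2 j], of a1 b1 i]
    show "(\<lambda>u t. (u * a1 + t * b1) ^ i * ((u * a2 + t * b2) ^ j *
      ((u * a3 + t * b3) ^ (d - i - j) * c i j))) \<in> binary_forms d"
      using ij by simp
  qed
  moreover have "form_value F (add3 (smul3 u p1) (smul3 t p2)) = (\<Sum>i\<le>d. \<Sum>j\<le>d - i.
      (u * a1 + t * b1) ^ i * ((u * a2 + t * b2) ^ j * ((u * a3 + t * b3) ^ (d - i - j) * c i j)))" for u t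
    unfolding F p1 p2 smul3.simps add3.simps form_value_form form_eval_def
    by (intro sum.cong refl) (simp add: mult_ac)
  ultimately show ?thesis by simp
qed

lemma card_monomials: "card (SIGMA i:{..d}. {..d - i}) = (d + 2) choose 2"
proof -
  have "card (SIGMA i:{..d}. {..d - i}) = (\<Sum>i\<le>d. Suc (d - i))"
    by simp
  also have "\<dots> = (\<Sum>i\<le>d. Suc i)"
    by (rule sum.reindex_bij_witness[of _ "\<lambda>i. d - i" "\<lambda>i. d - i"]) auto
  also have "\<dots> = (d + 2) choose 2"
    by (induction d) (auto simp: numeral_2_eq_2)
  finally show ?thesis .
qed

section \<open>The code and its dual\<close>

text \<open>A frame is fixed at each \<open>P i\<close> once and for all; through
  \<open>vanishes_iff\<close> the germs can then be forgotten in favour of the tangent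
  curves.\<close>

locale collinear_code = hermitian_field q ty
  for q :: nat and ty :: "'a::{field,finite} itself" +
  fixes d s :: nat and a :: "nat \<Rightarrow> nat" and P :: "nat \<Rightarrow> 'a pt3 set" and R :: "'a pt3 set set"
    and rep :: "'a pt3 set \<Rightarrow> 'a pt3" and p v \<xi> \<eta> :: "nat \<Rightarrow> 'a pt3"
  assumes s_ge: "2 \<le> s" and s_less: "s < d" and d_less: "d < q"
    and a_pos: "\<And>i. i \<in> {1..s} \<Longrightarrow> 0 < a i"
    and a_le: "\<And>i. i \<in> {1..s} \<Longrightarrow> a i \<le> d + 1 - i"
    and P_on_X: "\<And>i. i \<in> {1..s} \<Longrightarrow> P i \<in> herm_points q"
    and P_distinct: "inj_on P {1..s}"
    and R_line: "is_line R"
    and P_on_R: "\<And>i. i \<in> {1..s} \<Longrightarrow> P i \<in> R"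
    and rep_ok: "\<And>Q. Q \<in> herm_points q - P ` {1..s} \<Longrightarrow> rep Q \<in> Q"
    and p_in_P: "\<And>i. i \<in> {1..s} \<Longrightarrow> p i \<in> P i"
    and frame: "\<And>i. i \<in> {1..s} \<Longrightarrow> dot3 (\<xi> i) (p i) = 1" "\<And>i. i \<in> {1..s} \<Longrightarrow> dot3 (\<xi> i) (v i) = 0"
      "\<And>i. i \<in> {1..s} \<Longrightarrow> dot3 (\<eta> i) (p i) = 0" "\<And>i. i \<in> {1..s} \<Longrightarrow> dot3 (\<eta> i) (v i) = 1"
      "\<And>i. i \<in> {1..s} \<Longrightarrow> dot3 (tangent_form q (p i)) (v i) = 0"
    and vanishes_iff: "\<And>i d c b. i \<in> {1..s} \<Longrightarrow> b \<le> q \<Longrightarrow>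
      vanishes_on_multpoint q d c (P i) b = (fps_X ^ b dvd form d c (tangent_curve (p i) (v i)))"
begin

definition "B = herm_points q - P ` {1..s}"
definition "C = herm_code q d B rep s P a"
abbreviation "\<gamma> i \<equiv> tangent_curve (p i) (v i)"
abbreviation "\<tau> i \<equiv> tangent_form q (p i)"

definition vanishing_forms :: "('a fps pt3 \<Rightarrow> 'a fps) set" where
  "vanishing_forms = {F \<in> forms d. \<forall>i\<in>{1..s}. fps_X ^ a i dvd F (\<gamma> i)}"

definition eval_word :: "('a fps pt3 \<Rightarrow> 'a fps) \<Rightarrow> 'a pt3 set \<Rightarrow> 'a" where
  "eval_word F = (\<lambda>Q. if Q \<in> B then form_value F (rep Q) else 0)"

text \<open>The tangent criterion applies to all multiplicities in \<open>E\<close> because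
  \<open>a i \<le> d < q\<close>.\<close>

lemma C_eq: "C = eval_word ` vanishing_forms"
proof -
  have "(\<forall>i\<in>{1..s}. vanishes_on_multpoint q d c (P i) (a i)) \<longleftrightarrow> form d c \<in> vanishing_forms" for c
    using vanishes_iff a_le d_less s_less unfolding vanishing_forms_def by fastforce
  moreover have "(\<lambda>Q. if Q \<in> B then (case rep Q of (x, y, z) \<Rightarrow> form_eval d c x y z) else 0) = eval_word (form d c)" for c
    by (auto simp: eval_word_def fun_eq_iff form_value_form split: prod.split)
  ultimately have "C = {eval_word (form d c) | c. form d c \<in> vanishing_forms}"
    unfolding C_def herm_code_def by simp
  also have "\<dots> = eval_word ` vanishing_forms"
    by (auto simp: vanishing_forms_def forms_def)
  finally show ?thesis .
qed

lemma plane: "i \<in> {1..s} \<Longrightarrow> P i \<in> proj_plane" "Q \<in> B \<Longrightarrow> Q \<in> proj_plane"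
  using P_on_X herm_points_in_plane by (auto simp: B_def)

lemma rep_in: "Q \<in> B \<Longrightarrow> rep Q \<in> Q"
  using rep_ok by (simp add: B_def)

lemma tau_self: "i \<in> {1..s} \<Longrightarrow> dot3 (\<tau> i) (p i) = 0"
  using in_herm_points_iff[OF plane(1) p_in_P] P_on_X by (simp add: tangent_form_dot_self)

lemma tau_other: "i \<in> {1..s} \<Longrightarrow> j \<in> {1..s} \<Longrightarrow> i \<noteq> j \<Longrightarrow> dot3 (\<tau> i) (p j) \<noteq> 0"
  using tangent_form_nonzero[OF P_on_X p_in_P P_on_X p_in_P] inj_onD[OF P_distinct] by blast

lemma tau_rep: "i \<in> {1..s} \<Longrightarrow> Q \<in> B \<Longrightarrow> dot3 (\<tau> i) (rep Q) \<noteq> 0"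
  by (rule tangent_form_nonzero[OF P_on_X p_in_P _ rep_in]) (auto simp only: B_def)

lemma lin_tau_self: "i \<in> {1..s} \<Longrightarrow> lin (\<tau> i) (\<gamma> i) = 0"
  by (simp add: lin_tangent_curve tau_self frame)

lemma cross3_p: "i \<in> {1..s} \<Longrightarrow> j \<in> {1..s} \<Longrightarrow> i \<noteq> j \<Longrightarrow> cross3 (p i) (p j) \<noteq> (0, 0, 0)"
  using proj_eq_iff_cross3[OF plane(1) p_in_P plane(1) p_in_P] inj_onD[OF P_distinct] by blast

lemma cross3_rep: "Q \<in> B \<Longrightarrow> Q' \<in> B \<Longrightarrow> Q \<noteq> Q' \<Longrightarrow> cross3 (rep Q) (rep Q') \<noteq> (0, 0, 0)"
  using proj_eq_iff_cross3[OF plane(2) rep_in plane(2) rep_in] by blast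

lemma card_B: "card B = q ^ 3 + 1 - s"
  unfolding B_def using P_on_X card_herm_points card_image[OF P_distinct]
  by (subst card_Diff_subset) auto

text \<open>The jet interpolation with numbering from 1, hence \<open>e + 2 - i\<close>. For
  \<open>e = d - 1\<close> this is exactly the hypothesis
  \<open>a i \<le> d + 1 - i\<close>.\<close>

lemma ex_form_with_tangent_jets:
  assumes "\<And>i. i \<in> {1..s} \<Longrightarrow> b i \<le> e + 2 - i" "s \<le> e + 1"
  shows "\<exists>F\<in>forms e. \<forall>i\<in>{1..s}. fps_X ^ b i dvd F (\<gamma> i) - g i"
proof -
  have "\<exists>F\<in>forms e. \<forall>i<s. fps_X ^ b (Suc i) dvd F (\<gamma> (Suc i)) - g (Suc i)"
  proof (rule ex_form_with_jets[where \<xi> = "\<lambda>i. \<xi> (Suc i)" and \<eta> = "\<lambda>i. \<eta> (Suc i)" and \<tau> = "\<lambda>i. \<tau> (Suc i)"])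
    show "b (Suc i) \<le> e + 1 - i" if "i < s" for i
      using assms(1)[of "Suc i"] that by simp
    show "fps_nth (lin (\<tau> (Suc i)) (\<gamma> (Suc j))) 0 \<noteq> 0" if "i < s" "j < s" "i \<noteq> j" for i j
      using tau_other[of "Suc i" "Suc j"] that by (simp add: lin_tangent_curve)
  qed (use assms frame lin_tau_self in \<open>auto simp: lin_tangent_curve\<close>)
  moreover have "\<exists>j<s. i = Suc j" if "i \<in> {1..s}" for i
    using that by (cases i) auto
  ultimately show ?thesis by metis
qed

section \<open>Dual words of small weight\<close>

lemma dual_zero_at:
  assumes w: "w \<in> dual_code B C" and F: "F \<in> vanishing_forms" and Q: "Q \<in> B"
    and 0: "\<And>Q'. Q' \<in> supp B w \<Longrightarrow> Q' \<noteq> Q \<Longrightarrow> form_value F (rep Q') = 0"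
    and n0: "form_value F (rep Q) \<noteq> 0"
  shows "w Q = 0"
proof -
  have "(\<Sum>Q\<in>B. eval_word F Q * w Q) = 0"
    using w F unfolding dual_code_def C_eq by blast
  \<comment> \<open>At every other point either the word or the form vanishes, so a single term of
    the dot product survives.\<close>
  also have "(\<Sum>Q\<in>B. eval_word F Q * w Q) = (\<Sum>Q'\<in>{Q}. eval_word F Q' * w Q')"
    using Q 0 by (intro sum.mono_neutral_right) (auto simp: eval_word_def supp_def)
  finally show ?thesis using Q n0 by (simp add: eval_word_def)
qed

text \<open>The \<open>s\<close> tangents take care of \<open>E\<close> without vanishing on
  \<open>B\<close>, which leaves \<open>d - s\<close> linear factors for separating \<open>Q\<close>
  from the rest of the support.\<close>

lemma dual_zero_if_tangent_product:
  assumes w: "w \<in> dual_code B C" and Q: "Q \<in> B"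
    and N: "finite N" "s + card N \<le> d" "\<And>l. l \<in> N \<Longrightarrow> dot3 l (rep Q) \<noteq> 0"
    and cover: "\<And>Q'. Q' \<in> supp B w \<Longrightarrow> Q' \<noteq> Q \<Longrightarrow> \<exists>l\<in>N. dot3 l (rep Q') = 0"
  shows "w Q = 0"
proof -
  let ?N = "\<tau> ` {1..s} \<union> N"
  have one: "1 \<in> {1..s}" using s_ge by simp
  have "card ?N \<le> d"
    using N(1,2) card_Un_le[of "\<tau> ` {1..s}" N] card_image_le[of "{1..s}" \<tau>] by simp
  moreover have "finite ?N" using N(1) by simp
  moreover have "dot3 l (rep Q) \<noteq> 0" if "l \<in> ?N" for l
    using that N(3) tau_rep[OF _ Q] by blast
  ultimately obtain F where F: "F \<in> forms d" "form_value F (rep Q) \<noteq> 0"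
      "\<And>\<gamma> l. l \<in> ?N \<Longrightarrow> lin l \<gamma> dvd F \<gamma>"
    using ex_product_form[of ?N d "rep Q" "\<tau> 1"] tau_rep[OF one Q] by blast
  have "F (\<gamma> i) = 0" if "i \<in> {1..s}" for i
    using F(3)[of "\<tau> i" "\<gamma> i"] lin_tau_self that by simp
  then have "F \<in> vanishing_forms" using F(1) by (simp add: vanishing_forms_def)
  then show ?thesis
    using dual_zero_at[OF w _ Q _ F(2)] cover form_value_eq_0_if_lin_dvd[of _ F] F(3) by blast
qed

lemma sep_form:
  assumes "Q \<in> B"
  obtains sep where "\<And>Q'. Q' \<in> B \<Longrightarrow> Q' \<noteq> Q \<Longrightarrow> dot3 (sep Q') (rep Q') = 0"
    "\<And>Q'. Q' \<in> B \<Longrightarrow> Q' \<noteq> Q \<Longrightarrow> dot3 (sep Q') (rep Q) \<noteq> 0"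
proof -
  have "\<forall>Q'. \<exists>l. Q' \<in> B \<and> Q' \<noteq> Q \<longrightarrow> dot3 l (rep Q') = 0 \<and> dot3 l (rep Q) \<noteq> 0"
    using ex_separating_form cross3_rep assms by metis
  then show ?thesis using that by metis
qed

lemma dual_min_weight:
  assumes w: "w \<in> dual_code B C" "w \<noteq> 0" and card: "card (supp B w) \<le> d + 2 - s"
  shows "card (supp B w) = d + 2 - s" "supp B w \<subseteq> R"
proof -
  define S where "S = supp B w"
  have SB: "S \<subseteq> B" and finS: "finite S" and wS: "\<And>Q. Q \<in> S \<Longrightarrow> w Q \<noteq> 0"
    by (auto simp: S_def supp_def)
  have "S \<noteq> {}"
    using w unfolding S_def supp_def dual_code_def by (auto simp: fun_eq_iff)
  note tangent_product = dual_zero_if_tangent_product[OF w(1), folded S_def]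
  have cardS: "card S = d + 2 - s"
  proof (rule ccontr)
    assume *: "card S \<noteq> d + 2 - s"
    obtain Q where Q: "Q \<in> S" using \<open>S \<noteq> {}\<close> by blast
    obtain sep where sep: "\<And>Q'. Q' \<in> B \<Longrightarrow> Q' \<noteq> Q \<Longrightarrow> dot3 (sep Q') (rep Q') = 0"
      "\<And>Q'. Q' \<in> B \<Longrightarrow> Q' \<noteq> Q \<Longrightarrow> dot3 (sep Q') (rep Q) \<noteq> 0"
      using sep_form Q SB by blast
    \<comment> \<open>With at most \<open>d + 1 - s\<close> support points, one line for each point
      other than \<open>Q\<close> needs at most \<open>d - s\<close> factors.\<close>
    have "card (sep ` (S - {Q})) \<le> card S - 1"
      using card_image_le[of "S - {Q}" sep] finS Q by simp
    then have "s + card (sep ` (S - {Q})) \<le> d"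
      using * card s_less by (simp add: S_def)
    moreover have "dot3 l (rep Q) \<noteq> 0" if "l \<in> sep ` (S - {Q})" for l
      using that sep(2) SB by blast
    moreover have "\<exists>l\<in>sep ` (S - {Q}). dot3 l (rep Q') = 0" if "Q' \<in> S" "Q' \<noteq> Q" for Q'
      using that sep(1) SB by blast
    ultimately have "w Q = 0"
      using tangent_product[of Q "sep ` (S - {Q})"] SB Q finS by blast
    then show False using wS Q by blast
  qed
  then show "card (supp B w) = d + 2 - s" by (simp add: S_def)
  \<comment> \<open>Collinearity of the support: if \<open>Q\<close> lay off the line
    \<open>A A'\<close>, that line would cover two points with one factor, giving
    \<open>1 + (d - s - 1) = d - s\<close> factors in all.\<close>
  have det0: "dot3 (cross3 (rep A) (rep A')) (rep Q) = 0" if QAA: "Q \<in> S" "A \<in> S" "A' \<in> S" for Q A A'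
  proof (rule ccontr)
    assume n0: "dot3 (cross3 (rep A) (rep A')) (rep Q) \<noteq> 0"
    have "cross3 (rep A) (rep A) = (0, 0, 0)" by (cases "rep A") simp
    then have "A \<noteq> A'" using n0 by (cases "rep Q") auto
    moreover have "A \<noteq> Q" "A' \<noteq> Q" using n0 by auto
    ultimately have "card (S - {Q, A, A'}) = card S - 3"
      using QAA finS by (subst card_Diff_subset) auto
    then have c3: "card (S - {Q, A, A'}) = d - s - 1" using cardS by simp
    obtain sep where sep: "\<And>Q'. Q' \<in> B \<Longrightarrow> Q' \<noteq> Q \<Longrightarrow> dot3 (sep Q') (rep Q') = 0"
      "\<And>Q'. Q' \<in> B \<Longrightarrow> Q' \<noteq> Q \<Longrightarrow> dot3 (sep Q') (rep Q) \<noteq> 0"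
      using sep_form[of Q] QAA(1) SB by blast
    let ?N = "insert (cross3 (rep A) (rep A')) (sep ` (S - {Q, A, A'}))"
    have "card ?N \<le> Suc (card (sep ` (S - {Q, A, A'})))" by (rule card_insert_le_m1) auto
    then have "s + card ?N \<le> d"
      using card_image_le[of "S - {Q, A, A'}" sep] finS c3 s_less by simp
    moreover have "dot3 l (rep Q) \<noteq> 0" if "l \<in> ?N" for l
      using that sep(2) SB n0 by blast
    moreover have "\<exists>l\<in>?N. dot3 l (rep Q') = 0" if "Q' \<in> S" "Q' \<noteq> Q" for Q'
    proof (cases "Q' = A \<or> Q' = A'")
      case True
      then show ?thesis by auto
    next
      case False
      then show ?thesis using that sep(1)[of Q'] SB by blast
    qed
    ultimately have "w Q = 0"
      using tangent_product[of Q ?N] SB QAA(1) finS by blast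
    then show False using wS QAA by blast
  qed
  show "supp B w \<subseteq> R"
    unfolding S_def[symmetric]
  proof (rule ccontr)
    assume notR: "\<not> S \<subseteq> R"
    obtain Q where Q: "Q \<in> S" using \<open>S \<noteq> {}\<close> by blast
    have "\<exists>A\<in>S. A \<noteq> Q"
    proof (rule ccontr)
      assume "\<not> ?thesis"
      then have "S \<subseteq> {Q}" by blast
      then have "card S \<le> 1" using card_mono[of "{Q}" S] by simp
      then show False using cardS s_less by simp
    qed
    then obtain A where A: "A \<in> S" "A \<noteq> Q" by blast
    define l where "l = cross3 (rep Q) (rep A)"
    have l0: "l \<noteq> (0, 0, 0)" unfolding l_def using cross3_rep A Q SB by (metis subsetD)
    have lS: "dot3 l (rep T) = 0" if "T \<in> S" for T
      unfolding l_def using det0[OF that Q A(1)] .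
    obtain \<rho>1 \<rho>2 \<rho>3 where R: "R = proj_line \<rho>1 \<rho>2 \<rho>3" using R_line by (auto simp: is_line_def)
    \<comment> \<open>The indices of the \<open>P i\<close> on the line \<open>l\<close> of the
      support. Two of them would force \<open>l\<close> to define \<open>R\<close>, contrary to
      \<open>notR\<close>.\<close>
    define Z where "Z = {i \<in> {1..s}. dot3 l (p i) = 0}"
    have Zone: "i = j" if Zij: "i \<in> Z" "j \<in> Z" for i j
    proof (rule ccontr)
      assume "i \<noteq> j"
      then have cr: "cross3 (p i) (p j) \<noteq> (0, 0, 0)" using cross3_p that by (simp add: Z_def)
      have ij: "i \<in> {1..s}" "j \<in> {1..s}" and "dot3 l (p i) = 0" "dot3 l (p j) = 0"
        using Zij by (auto simp: Z_def)
      then obtain k where k: "l = smul3 k (cross3 (p i) (p j))"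
        using orthogonal_imp_multiple_of_cross3[OF cr] by blast
      have "dot3 (\<rho>1, \<rho>2, \<rho>3) (p i) = 0" "dot3 (\<rho>1, \<rho>2, \<rho>3) (p j) = 0"
        using P_on_R ij in_proj_line_iff[OF plane(1) p_in_P] unfolding R by blast+
      then obtain k' where k': "(\<rho>1, \<rho>2, \<rho>3) = smul3 k' (cross3 (p i) (p j))"
        using orthogonal_imp_multiple_of_cross3[OF cr] by blast
      have "k \<noteq> 0" using k l0 by (cases "cross3 (p i) (p j)") auto
      have "T \<in> R" if "T \<in> S" for T
      proof -
        have "dot3 (cross3 (p i) (p j)) (rep T) = 0"
          using lS[OF that] \<open>k \<noteq> 0\<close> unfolding k by simp
        then have "dot3 (\<rho>1, \<rho>2, \<rho>3) (rep T) = 0" unfolding k' by simp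
        then show ?thesis unfolding R using in_proj_line_iff[OF plane(2) rep_in] that SB by blast
      qed
      then show False using notR by blast
    qed
    have "card Z \<le> 1"
      using Zone card_le_Suc0_iff_eq[of Z] by (simp add: Z_def)
    obtain sep where sep: "\<And>Q'. Q' \<in> B \<Longrightarrow> Q' \<noteq> Q \<Longrightarrow> dot3 (sep Q') (rep Q') = 0"
      "\<And>Q'. Q' \<in> B \<Longrightarrow> Q' \<noteq> Q \<Longrightarrow> dot3 (sep Q') (rep Q) \<noteq> 0"
      using sep_form Q SB by blast
    \<comment> \<open>Lines separating \<open>Q\<close> together with the tangent at the possible
      \<open>P i\<close> on \<open>l\<close>, where a multiple of \<open>l\<close> cannot correct
      arbitrary jets. There are at most \<open>(d + 1 - s) + 1 \<le> d\<close> factors since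
      \<open>s \<ge> 2\<close>.\<close>
    let ?N = "sep ` (S - {Q}) \<union> \<tau> ` Z"
    have "finite Z" by (simp add: Z_def)
    have "card ?N \<le> card (sep ` (S - {Q})) + card (\<tau> ` Z)" by (rule card_Un_le)
    also have "\<dots> \<le> (card S - 1) + card Z"
      using card_image_le[of "S - {Q}" sep] card_image_le[OF \<open>finite Z\<close>, of \<tau>] finS Q by simp
    also have "\<dots> \<le> d" using \<open>card Z \<le> 1\<close> cardS s_ge s_less by simp
    finally have cN: "card ?N \<le> d" .
    have QB: "Q \<in> B" using Q SB by blast
    have one: "1 \<in> {1..s}" using s_ge by simp
    have ne: "dot3 m (rep Q) \<noteq> 0" if "m \<in> ?N" for m
      using that sep(2) SB tau_rep[OF _ QB] by (auto simp: Z_def)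
    have "finite ?N" using finS \<open>finite Z\<close> by simp
    then obtain F0 where F0: "F0 \<in> forms d" "form_value F0 (rep Q) \<noteq> 0"
        "\<And>\<gamma> m. m \<in> ?N \<Longrightarrow> lin m \<gamma> dvd F0 \<gamma>"
      using ex_product_form[of ?N d "rep Q" "\<tau> 1", OF _ cN ne tau_rep[OF one QB]] by blast
    \<comment> \<open>Outside \<open>Z\<close> the form \<open>l\<close> is a unit on the tangent
      curve, and this jet of \<open>G\<close> makes \<open>F0 + l G\<close> vanish to order
      \<open>a i\<close>. On \<open>Z\<close> the form \<open>F0\<close> already vanishes, so the
      target is 0.\<close>
    define g where "g i = (if i \<in> Z then 0 else - F0 (\<gamma> i) * inverse (lin l (\<gamma> i)))" for i
    obtain G where G: "G \<in> forms (d - 1)" "\<And>i. i \<in> {1..s} \<Longrightarrow> fps_X ^ a i dvd G (\<gamma> i) - g i"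
    proof -
      have "a i \<le> d - 1 + 2 - i" if "i \<in> {1..s}" for i using a_le[OF that] s_less by simp
      then have "\<exists>G\<in>forms (d - 1). \<forall>i\<in>{1..s}. fps_X ^ a i dvd G (\<gamma> i) - g i"
        using s_less by (intro ex_form_with_tangent_jets) auto
      then show ?thesis using that by blast
    qed
    define F where "F x = F0 x + lin l x * G x" for x
    have "F \<in> forms d"
      unfolding F_def using forms_add[OF F0(1)] forms_lin_mult[OF G(1), of l] s_less by simp
    moreover have "fps_X ^ a i dvd F (\<gamma> i)" if i: "i \<in> {1..s}" for i
    proof -
      have "F (\<gamma> i) = lin l (\<gamma> i) * (G (\<gamma> i) - g i)"
      proof (cases "i \<in> Z")
        case True
        then have "F0 (\<gamma> i) = 0" using F0(3)[of "\<tau> i" "\<gamma> i"] lin_tau_self[OF i] by simp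
        then show ?thesis using True by (simp add: F_def g_def)
      next
        case False
        then have "fps_nth (lin l (\<gamma> i)) 0 \<noteq> 0" using i by (simp add: Z_def lin_tangent_curve)
        then have "inverse (lin l (\<gamma> i)) * lin l (\<gamma> i) = 1" by (rule inverse_mult_eq_1)
        then show ?thesis using False by (simp add: F_def g_def algebra_simps)
      qed
      then show ?thesis using G(2)[OF i] by simp
    qed
    ultimately have "F \<in> vanishing_forms" by (simp add: vanishing_forms_def)
    \<comment> \<open>The correction is a multiple of \<open>l\<close>, which vanishes on
      \<open>S\<close>, so the separation of \<open>Q\<close> survives.\<close>
    moreover have Fval: "form_value F (rep T) = form_value F0 (rep T)" if "T \<in> S" for T
      using lS[OF that] unfolding F_def by (simp add: form_value_add form_value_mult form_value_lin)
    moreover have "form_value F0 (rep T) = 0" if "T \<in> S" "T \<noteq> Q" for T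
      using that SB sep(1)[of T] form_value_eq_0_if_lin_dvd[of "sep T" F0] F0(3) by blast
    ultimately have "w Q = 0"
      using dual_zero_at[OF w(1) _ QB, folded S_def, of F] F0(2) Q by metis
    then show False using wS Q by blast
  qed
qed

end

section \<open>Dual words supported on the line \<open>R\<close>\<close>

context collinear_code
begin

text \<open>A linear relation among \<open>d + 2\<close> points of \<open>R\<close>, namely
  \<open>S\<close> and all \<open>P i\<close>, annihilates every form of degree \<open>d\<close>.
  Forms in the code vanish at the \<open>P i\<close>, so the part of the relation on
  \<open>S\<close> is a dual word.\<close>

lemma ex_dual_word_in_secant:
  assumes S: "S \<subseteq> R \<inter> B" "card S = d + 2 - s"
  shows "\<exists>w\<in>dual_code B C. w \<noteq> 0 \<and> supp B w \<subseteq> S"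
proof -
  \<comment> \<open>\<open>rep\<close> is only constrained on \<open>B\<close>, so representatives
    of the \<open>P i\<close> are chosen separately.\<close>
  define r where "r Q = (if Q \<in> B then rep Q else SOME x. x \<in> Q)" for Q
  define T where "T = S \<union> P ` {1..s}"
  have disj: "S \<inter> P ` {1..s} = {}" using S by (auto simp: B_def)
  have "finite S" by simp
  have cardT: "card T = d + 2"
    unfolding T_def using disj S(2) card_image[OF P_distinct] s_less by (subst card_Un_disjoint) auto
  have Tplane: "Q \<in> proj_plane" if "Q \<in> T" for Q using that S plane by (auto simp: T_def)
  have rT: "r Q \<in> Q" if "Q \<in> T" for Q
    using that rep_in someI_ex[OF proj_plane_nonempty[OF Tplane[OF that]]] unfolding r_def by simp
  have TR: "Q \<in> R" if "Q \<in> T" for Q using that S P_on_R by (auto simp: T_def)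
  have one: "1 \<in> {1..s}" and two: "2 \<in> {1..s}" using s_ge by auto
  have cr: "cross3 (p 1) (p 2) \<noteq> (0, 0, 0)" using cross3_p[OF one two] by simp
  obtain \<rho>1 \<rho>2 \<rho>3 where R: "R = proj_line \<rho>1 \<rho>2 \<rho>3" and \<rho>: "(\<rho>1, \<rho>2, \<rho>3) \<noteq> (0, 0, 0)"
    using R_line unfolding is_line_def by blast
  have "dot3 (\<rho>1, \<rho>2, \<rho>3) (p i) = 0" if "i \<in> {1..s}" for i
    using P_on_R[OF that] in_proj_line_iff[OF plane(1)[OF that] p_in_P[OF that]] unfolding R by blast
  then obtain k where k: "(\<rho>1, \<rho>2, \<rho>3) = smul3 k (cross3 (p 1) (p 2))"
    using orthogonal_imp_multiple_of_cross3[OF cr] one two by blast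
  have "k \<noteq> 0" using k \<rho> by (cases "cross3 (p 1) (p 2)") auto
  have "\<exists>u t. r Q = add3 (smul3 u (p 1)) (smul3 t (p 2))" if "Q \<in> T" for Q
  proof -
    have "dot3 (\<rho>1, \<rho>2, \<rho>3) (r Q) = 0"
      using TR[OF that] in_proj_line_iff[OF Tplane[OF that] rT[OF that]] unfolding R by blast
    then have "dot3 (cross3 (p 1) (p 2)) (r Q) = 0" using \<open>k \<noteq> 0\<close> unfolding k by simp
    then show ?thesis by (rule in_span_if_dot3_cross3_eq_0[OF cr])
  qed
  then obtain u t where ut: "\<And>Q. Q \<in> T \<Longrightarrow> r Q = add3 (smul3 (u Q) (p 1)) (smul3 (t Q) (p 2))"
    by metis
  obtain w0 where w0: "\<And>Q. Q \<notin> T \<Longrightarrow> w0 Q = 0" "w0 \<noteq> 0"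
      "\<And>k. k < d + 1 \<Longrightarrow> (\<Sum>Q\<in>T. w0 Q * (u Q ^ (d - k) * t Q ^ k)) = 0"
    using ex_nonzero_annihilator[of T "d + 1" "\<lambda>k Q. u Q ^ (d - k) * t Q ^ k"] cardT by auto
  have ann: "(\<Sum>Q\<in>T. w0 Q * form_value F (r Q)) = 0" if F: "F \<in> forms d" for F
  proof -
    obtain f where "\<And>u t. form_value F (add3 (smul3 u (p 1)) (smul3 t (p 2))) = (\<Sum>k\<le>d. f k * (u ^ (d - k) * t ^ k))"
      using forms_restrict_to_line[OF F, of "p 1" "p 2"] unfolding binary_forms_def by blast
    then have "(\<Sum>Q\<in>T. w0 Q * form_value F (r Q)) = (\<Sum>Q\<in>T. \<Sum>k\<le>d. f k * (w0 Q * (u Q ^ (d - k) * t Q ^ k)))"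
      by (intro sum.cong refl) (simp add: ut sum_distrib_left mult_ac)
    also have "\<dots> = (\<Sum>k\<le>d. f k * (\<Sum>Q\<in>T. w0 Q * (u Q ^ (d - k) * t Q ^ k)))"
      by (subst sum.swap) (simp add: sum_distrib_left)
    also have "\<dots> = 0" using w0(3) by (intro sum.neutral) auto
    finally show ?thesis .
  qed
  have rP: "\<exists>k. k \<noteq> 0 \<and> r (P i) = smul3 k (p i)" if i: "i \<in> {1..s}" for i
  proof -
    have "r (P i) \<in> P i" using rT i by (simp add: T_def)
    then show ?thesis using in_proj_planeD(2)[OF plane(1)[OF i] p_in_P[OF i]] by (auto simp: proj_class_eq)
  qed
  define w where "w Q = (if Q \<in> S then w0 Q else 0)" for Q
  \<comment> \<open>A relation concentrated on the \<open>P i\<close> is impossible: the product of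
    the tangents at the other points, padded to degree \<open>d\<close>, isolates a single
    \<open>P i\<close> with nonzero coefficient.\<close>
  have "w \<noteq> 0"
  proof
    assume "w = 0"
    then have w0S: "w0 Q = 0" if "Q \<in> S" for Q using that by (metis w_def zero_fun_apply)
    obtain Q where "w0 Q \<noteq> 0" using w0(2) by (auto simp only: fun_eq_iff zero_fun_apply)
    then have "Q \<in> P ` {1..s}" using w0(1) w0S unfolding T_def by blast
    then obtain i where i: "i \<in> {1..s}" "w0 (P i) \<noteq> 0" using \<open>w0 Q \<noteq> 0\<close> by blast
    obtain j where j: "j \<in> {1..s}" "j \<noteq> i"
      using that[of 1] that[of 2] one two by (cases "i = 1") auto
    obtain k where rk: "k \<noteq> 0" "r (P i) = smul3 k (p i)" using rP i by blast
    let ?N = "\<tau> ` ({1..s} - {i})"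
    have "card ?N \<le> d" using card_image_le[of "{1..s} - {i}" \<tau>] s_less i by simp
    moreover have "dot3 l (p i) \<noteq> 0" if "l \<in> ?N" for l using that tau_other i by blast
    ultimately obtain F where F: "F \<in> forms d" "form_value F (p i) \<noteq> 0"
        "\<And>\<gamma> l. l \<in> ?N \<Longrightarrow> lin l \<gamma> dvd F \<gamma>"
      using ex_product_form[of ?N d "p i" "\<tau> j"] tau_other[OF j(1) i(1) j(2)] by blast
    have "form_value F (r (P j)) = 0" if j: "j \<in> {1..s}" "j \<noteq> i" for j
    proof -
      obtain k where "r (P j) = smul3 k (p j)" using rP j by blast
      moreover have "form_value F (p j) = 0"
        using form_value_eq_0_if_lin_dvd[of "\<tau> j" F] F(3) tau_self[OF j(1)] j by blast
      ultimately show ?thesis using form_value_smul3[OF F(1)] by simp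
    qed
    then have "w0 Q * form_value F (r Q) = 0" if "Q \<in> T - {P i}" for Q
      using that w0S by (auto simp only: T_def mult_eq_0_iff)
    then have "(\<Sum>Q\<in>T. w0 Q * form_value F (r Q)) = (\<Sum>Q\<in>{P i}. w0 Q * form_value F (r Q))"
      using i(1) by (intro sum.mono_neutral_right) (auto simp only: T_def finite)
    then show False using ann[OF F(1)] F(2) i(2) rk form_value_smul3[OF F(1)] by simp
  qed
  moreover have "w \<in> dual_code B C"
  proof -
    have "(\<Sum>Q\<in>B. eval_word F Q * w Q) = 0" if F: "F \<in> vanishing_forms" for F
    proof -
      have Fd: "F \<in> forms d" using F by (simp add: vanishing_forms_def)
      have "form_value F (r (P i)) = 0" if i: "i \<in> {1..s}" for i
      proof -
        \<comment> \<open>As \<open>a i > 0\<close>, vanishing on \<open>E\<close> includes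
          vanishing at the point itself.\<close>
        have "fps_X ^ a i dvd F (\<gamma> i)" using F i by (simp add: vanishing_forms_def)
        then have "form_value F (p i) = 0"
          using a_pos[OF i] form_value_tangent_curve[OF Fd, of "p i" "v i"]
          unfolding fps_X_power_dvd_iff by simp
        then show ?thesis using rP[OF i] form_value_smul3[OF Fd] by (metis mult_zero_right)
      qed
      then have "(\<Sum>Q\<in>T. w0 Q * form_value F (r Q)) = (\<Sum>Q\<in>S. w0 Q * form_value F (r Q))"
        by (intro sum.mono_neutral_right) (auto simp: T_def)
      moreover have "(\<Sum>Q\<in>B. eval_word F Q * w Q) = (\<Sum>Q\<in>S. eval_word F Q * w Q)"
        using S(1) by (intro sum.mono_neutral_right) (auto simp: w_def)
      moreover have "(\<Sum>Q\<in>S. eval_word F Q * w Q) = (\<Sum>Q\<in>S. w0 Q * form_value F (r Q))"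
        using S(1) by (intro sum.cong refl) (auto simp: w_def eval_word_def r_def)
      ultimately show ?thesis using ann[OF Fd] by simp
    qed
    moreover have "w Q = 0" if "Q \<notin> B" for Q using that S(1) by (auto simp: w_def)
    ultimately show ?thesis unfolding dual_code_def C_eq by auto
  qed
  moreover have "supp B w \<subseteq> S" by (auto simp: supp_def w_def)
  ultimately show ?thesis by blast
qed

text \<open>The line has at least \<open>q + 1 - s\<close> points in \<open>B\<close>, and
  \<open>d < q\<close>.\<close>

lemma card_secant_points_ge: "d + 2 - s \<le> card (R \<inter> B)"
proof -
  have "1 \<in> {1..s}" "2 \<in> {1..s}" "P 1 \<noteq> P 2"
    using s_ge inj_onD[OF P_distinct, of 1 2] by auto
  then have "q + 1 \<le> card (R \<inter> herm_points q)"
    using card_secant_ge P_on_X P_on_R R_line by blast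
  moreover have "R \<inter> B = R \<inter> herm_points q - P ` {1..s}" by (auto simp: B_def)
  moreover have "card (R \<inter> herm_points q) - card (P ` {1..s}) \<le> card (R \<inter> herm_points q - P ` {1..s})"
    by (rule diff_card_le_card_Diff) simp
  ultimately show ?thesis using card_image[OF P_distinct] d_less by simp
qed

section \<open>Dimension of the code\<close>

lemma subspace_C: "fscale.subspace C"
proof (rule fscale.subspaceI)
  have "(\<lambda>v. 0) \<in> vanishing_forms" by (simp add: vanishing_forms_def forms_0)
  moreover have "eval_word (\<lambda>v. 0) = 0" by (auto simp: eval_word_def form_value_def fun_eq_iff)
  ultimately show "0 \<in> C" unfolding C_eq by (simp add: rev_image_eqI)
next
  fix x y assume "x \<in> C" "y \<in> C"
  then obtain F G where F: "F \<in> vanishing_forms" "x = eval_word F" and G: "G \<in> vanishing_forms" "y = eval_word G"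
    unfolding C_eq by blast
  have "(\<lambda>v. F v + G v) \<in> vanishing_forms"
    using F(1) G(1) by (auto simp: vanishing_forms_def forms_add dvd_add)
  moreover have "eval_word (\<lambda>v. F v + G v) = x + y"
    unfolding F G by (auto simp: eval_word_def form_value_add fun_eq_iff)
  ultimately show "x + y \<in> C" unfolding C_eq by (simp add: rev_image_eqI)
next
  fix k x assume "x \<in> C"
  then obtain F where F: "F \<in> vanishing_forms" "x = eval_word F" unfolding C_eq by blast
  have "(\<lambda>v. fps_const k * F v) \<in> vanishing_forms"
    using F(1) by (auto simp: vanishing_forms_def forms_scale)
  moreover have "eval_word (\<lambda>v. fps_const k * F v) = fscale k x"
    unfolding F by (auto simp: eval_word_def form_value_def fscale_def fun_eq_iff)
  ultimately show "fscale k x \<in> C" unfolding C_eq by (simp add: rev_image_eqI)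
qed

text \<open>The map from coefficients to jets along \<open>E\<close> is onto by interpolation, its
  kernel gives the vanishing forms, and evaluation is injective on it; counting all three yields the
  number of codewords.\<close>

lemma code_dim_C: "int (code_dim C) = int ((d + 2) choose 2) - int (\<Sum>i=1..s. a i)"
proof -
  \<comment> \<open>\<open>I\<close> indexes the monomials of degree \<open>d\<close> and
    \<open>D\<close> the jet coefficients prescribed by \<open>E\<close>; \<open>V\<close>
    normalises coefficients to 0 off \<open>I\<close>, making them unique.\<close>
  define I where "I = (SIGMA i:{..d}. {..d - i})"
  define D where "D = (SIGMA i:{1..s}. {..<a i})"
  define V where "V = {f :: nat \<times> nat \<Rightarrow> 'a. \<forall>x. x \<notin> I \<longrightarrow> f x = 0}"
  define fm where "fm f = form d (curry f)" for f :: "nat \<times> nat \<Rightarrow> 'a"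
  define J where "J f = (\<lambda>(i, n). if (i, n) \<in> D then fps_nth (fm f (\<gamma> i)) n else 0)" for f
  have finI: "finite I" and finD: "finite D" by (auto simp: I_def D_def)
  have I_iff: "(i, j) \<in> I \<longleftrightarrow> i + j \<le> d" for i j by (auto simp: I_def)
  have cardD: "card D = (\<Sum>i=1..s. a i)" unfolding D_def by (subst card_SigmaI) auto
  have fm_cong: "fm f = fm g" if "\<And>x. x \<in> I \<Longrightarrow> f x = g x" for f g
    unfolding fm_def form_def form_eval_fps_def using that by (auto simp: I_iff intro!: ext sum.cong)
  have fm_diff: "fm (f - g) v = fm f v - fm g v" for f g v
    using form_diff[of d "curry f" "curry g" v] by (simp add: fm_def curry_def)
  have ex_fm: "\<exists>f\<in>V. fm f = F" if F: "F \<in> forms d" for F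
  proof -
    obtain c where c: "F = form d c" using F by (auto simp: forms_def)
    define f where "f x = (if x \<in> I then case_prod c x else 0)" for x
    have "fm f = fm (case_prod c)" by (rule fm_cong) (simp add: f_def)
    then show ?thesis by (intro bexI[of _ f]) (auto simp: c fm_def V_def f_def)
  qed
  have "J ` V = {g. \<forall>x. x \<notin> D \<longrightarrow> g x = 0}"
  proof (intro equalityI subsetI)
    fix g :: "nat \<times> nat \<Rightarrow> 'a" assume g: "g \<in> {g. \<forall>x. x \<notin> D \<longrightarrow> g x = 0}"
    have "a i \<le> d + 2 - i" if "i \<in> {1..s}" for i using a_le[OF that] by simp
    then have "\<exists>F\<in>forms d. \<forall>i\<in>{1..s}. fps_X ^ a i dvd F (\<gamma> i) - Abs_fps (\<lambda>n. g (i, n))"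
      using s_less by (intro ex_form_with_tangent_jets) auto
    then obtain F where F: "F \<in> forms d" "\<And>i. i \<in> {1..s} \<Longrightarrow> fps_X ^ a i dvd F (\<gamma> i) - Abs_fps (\<lambda>n. g (i, n))"
      by blast
    obtain f where f: "f \<in> V" "fm f = F" using ex_fm[OF F(1)] by blast
    have "J f x = g x" for x
    proof (cases x)
      case (Pair i n)
      have "fps_nth (F (\<gamma> i)) n = g (i, n)" if "(i, n) \<in> D"
        using F(2)[of i] that by (auto simp: D_def fps_X_power_dvd_iff)
      then show ?thesis using g unfolding Pair J_def f(2) by simp
    qed
    then have "J f = g" by auto
    then show "g \<in> J ` V" using f(1) by blast
  qed (auto simp: J_def)
  then have card_im: "card (J ` V) = card (UNIV :: 'a set) ^ (\<Sum>i=1..s. a i)"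
    using card_supported_functions[OF finD, where ?'a = 'a] cardD by simp
  have finV: "finite V" unfolding V_def by (rule finite_supported_functions[OF finI])
  have card_V: "card V = card (J ` V) * card {f \<in> V. J f = 0}"
  proof (rule card_eq_card_image_times_card_kernel[OF finV])
    show "J (f - g) = J f - J g" for f g
      by (auto simp: J_def fm_diff fun_eq_iff)
  qed (auto simp: V_def)
  have card_V': "card V = card (UNIV :: 'a set) ^ ((d + 2) choose 2)"
    unfolding V_def card_supported_functions[OF finI] by (simp add: I_def card_monomials)
  have kernel: "J f = 0 \<longleftrightarrow> fm f \<in> vanishing_forms" for f
  proof -
    have "J f = 0 \<longleftrightarrow> (\<forall>i n. (i, n) \<in> D \<longrightarrow> fps_nth (fm f (\<gamma> i)) n = 0)"
      by (auto simp: J_def fun_eq_iff)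
    also have "\<dots> \<longleftrightarrow> (\<forall>i\<in>{1..s}. fps_X ^ a i dvd fm f (\<gamma> i))"
      unfolding D_def fps_X_power_dvd_iff by auto
    finally show ?thesis by (simp add: vanishing_forms_def fm_def)
  qed
  have C_im: "C = (\<lambda>f. eval_word (fm f)) ` {f \<in> V. J f = 0}"
  proof (intro equalityI subsetI)
    fix x assume "x \<in> C"
    then obtain F where F: "F \<in> vanishing_forms" "x = eval_word F" unfolding C_eq by blast
    then obtain f where "f \<in> V" "fm f = F" using ex_fm[of F] by (auto simp only: vanishing_forms_def)
    then show "x \<in> (\<lambda>f. eval_word (fm f)) ` {f \<in> V. J f = 0}" using F kernel by auto
  qed (auto simp: C_eq kernel)
  have "inj_on (\<lambda>f. eval_word (fm f)) V"
  proof (rule inj_onI)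
    fix f g assume fg: "f \<in> V" "g \<in> V" "eval_word (fm f) = eval_word (fm g)"
    have "curry (f - g) i j = 0" for i j
    proof (rule form_eq_0_if_vanishes_on_herm_points)
      show "curry (f - g) i j = 0" if "d < i + j" for i j
        using that fg(1,2) I_iff by (simp add: V_def)
      show "d < q" by (rule d_less)
      have "card (P ` {1..s}) + d < q * 2" using card_image[OF P_distinct] s_less d_less by simp
      also have "\<dots> \<le> q ^ 2" using q_gt_1 by (simp add: power2_eq_square)
      finally show "card (P ` {1..s}) + d < q ^ 2" .
      fix Q assume "Q \<in> herm_points q - P ` {1..s}"
      then have Q: "Q \<in> B" by (simp add: B_def)
      have "form_value (fm f) (rep Q) = form_value (fm g) (rep Q)"
        using fun_cong[OF fg(3), of Q] Q by (simp add: eval_word_def)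
      then have "form_value (fm (f - g)) (rep Q) = 0"
        by (simp add: form_value_def fm_diff)
      then show "\<exists>w\<in>Q. form_value (form d (curry (f - g))) w = 0"
        using rep_in[OF Q] unfolding fm_def by blast
    qed simp
    then show "f = g" by (auto simp: fun_eq_iff)
  qed
  then have "card C = card {f \<in> V. J f = 0}"
    unfolding C_im by (intro card_image) (auto elim: inj_on_subset)
  then have eq: "card (UNIV :: 'a set) ^ ((d + 2) choose 2) = card (UNIV :: 'a set) ^ (\<Sum>i=1..s. a i) * card C"
    using card_V card_V' card_im by simp
  have U: "card (UNIV :: 'a set) > 1" unfolding card_UNIV_field using q_gt_1 by (intro one_less_power) auto
  have finC: "finite C" unfolding C_im using finV by simp
  have "0 \<in> C" using subspace_C by (rule fscale.subspace_0)
  then have "card C > 0" using finC card_gt_0_iff by blast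
  \<comment> \<open>Since \<open>C\<close> is nonempty, the count gives this inequality, and the
    subtraction of natural numbers below does not truncate.\<close>
  then have "card (UNIV :: 'a set) ^ (\<Sum>i=1..s. a i) \<le> card (UNIV :: 'a set) ^ ((d + 2) choose 2)"
    unfolding eq by simp
  then have le: "(\<Sum>i=1..s. a i) \<le> (d + 2) choose 2"
    using U power_increasing_iff by blast
  have "card C = card (UNIV :: 'a set) ^ (((d + 2) choose 2) - (\<Sum>i=1..s. a i))"
  proof -
    have "card (UNIV :: 'a set) ^ (\<Sum>i=1..s. a i) * card C = card (UNIV :: 'a set) ^ (\<Sum>i=1..s. a i) *
        card (UNIV :: 'a set) ^ (((d + 2) choose 2) - (\<Sum>i=1..s. a i))"
      unfolding eq[symmetric] power_add[symmetric] using le by simp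
    then show ?thesis using U by simp
  qed
  then have "code_dim C = ((d + 2) choose 2) - (\<Sum>i=1..s. a i)"
    by (intro code_dim_eqI subspace_C finC)
  then show ?thesis using le by (simp add: of_nat_diff)
qed

section \<open>Minimum-weight words and minimum distance\<close>

lemma min_weight_word_supp:
  assumes "S \<subseteq> R \<inter> B" "card S = d + 2 - s"
  shows "\<exists>w\<in>dual_code B C. w \<noteq> 0 \<and> supp B w = S"
proof -
  obtain w where w: "w \<in> dual_code B C" "w \<noteq> 0" "supp B w \<subseteq> S"
    using ex_dual_word_in_secant[OF assms] by blast
  have "finite S" by simp
  then have "card (supp B w) \<le> d + 2 - s" using w(3) assms(2) card_mono by metis
  \<comment> \<open>A nonzero dual word of weight at most \<open>d + 2 - s\<close> has exactly this
    weight, so it fills \<open>S\<close>.\<close>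
  then have "card (supp B w) = card S" using dual_min_weight(1)[OF w(1,2)] assms(2) by simp
  then have "supp B w = S" using w(3) \<open>finite S\<close> card_subset_eq by blast
  then show ?thesis using w by blast
qed

text \<open>Subtracting the multiple that cancels one coordinate \<open>Q\<close> leaves a dual word
  of weight below \<open>d + 2 - s\<close>, which must be zero.\<close>

lemma min_weight_word_unique:
  assumes w: "w \<in> dual_code B C" "w \<noteq> 0" and w': "w' \<in> dual_code B C" "w' \<noteq> 0"
    and supp: "supp B w' = supp B w" "card (supp B w) = d + 2 - s"
  shows "\<exists>c. c \<noteq> 0 \<and> w' = fscale c w"
proof -
  have "supp B w \<noteq> {}" using supp(2) s_less by auto
  then obtain Q where Q: "Q \<in> supp B w" by blast
  then have wQ: "w Q \<noteq> 0" "w' Q \<noteq> 0" using supp(1) by (auto simp: supp_def)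
  define c where "c = w' Q / w Q"
  have "w' - fscale c w \<in> dual_code B C"
    using w(1) w'(1) unfolding dual_code_def
    by (auto simp: fscale_def algebra_simps sum_subtractf simp flip: sum_distrib_left)
  moreover have "card (supp B (w' - fscale c w)) < d + 2 - s"
  proof -
    have "supp B (w' - fscale c w) \<subseteq> supp B w - {Q}"
    proof
      fix T assume T: "T \<in> supp B (w' - fscale c w)"
      then have TB: "T \<in> B" and n0: "w' T - c * w T \<noteq> 0" by (simp_all add: supp_def fscale_def)
      have "T \<noteq> Q" using n0 wQ(1) by (metis c_def eq_iff_diff_eq_0 nonzero_eq_divide_eq)
      moreover have "T \<in> supp B w"
      proof (rule ccontr)
        assume "T \<notin> supp B w"
        moreover from this have "T \<notin> supp B w'" using supp(1) by simp
        ultimately have "w T = 0" "w' T = 0" using TB by (simp_all add: supp_def)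
        then show False using n0 by simp
      qed
      ultimately show "T \<in> supp B w - {Q}" by blast
    qed
    then have "card (supp B (w' - fscale c w)) \<le> card (supp B w - {Q})"
      by (intro card_mono) auto
    also have "\<dots> < card (supp B w)" using Q by (intro card_Diff1_less) auto
    finally show ?thesis using supp(2) by simp
  qed
  ultimately have "w' - fscale c w = 0"
    using dual_min_weight(1)[of "w' - fscale c w"] by fastforce
  then show ?thesis using wQ by (intro exI[of _ c]) (simp add: c_def)
qed

lemma min_dist_dual: "min_dist B (dual_code B C) = d + 2 - s"
  unfolding min_dist_def
proof (rule Min_eqI)
  have "{weight B w |w. w \<in> dual_code B C \<and> w \<noteq> 0} \<subseteq> {..card B}"
    by (auto simp: weight_def supp_def intro!: card_mono)
  then show "finite {weight B w |w. w \<in> dual_code B C \<and> w \<noteq> 0}"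
    using finite_subset by blast
next
  fix y assume "y \<in> {weight B w |w. w \<in> dual_code B C \<and> w \<noteq> 0}"
  then obtain w where w: "w \<in> dual_code B C" "w \<noteq> 0" "y = card (supp B w)"
    unfolding weight_def by blast
  then show "d + 2 - s \<le> y"
    using dual_min_weight(1)[OF w(1,2)] by linarith
next
  \<comment> \<open>The minimum is attained because \<open>R\<close> has enough points in
    \<open>B\<close> to carry a support.\<close>
  obtain S where S: "S \<subseteq> R \<inter> B" "card S = d + 2 - s"
    using card_secant_points_ge by (meson obtain_subset_with_card_n)
  then obtain w where "w \<in> dual_code B C" "w \<noteq> 0" "supp B w = S" using min_weight_word_supp by blast
  then show "d + 2 - s \<in> {weight B w |w. w \<in> dual_code B C \<and> w \<noteq> 0}"
    using S(2) unfolding weight_def by (intro CollectI exI[of _ w]) simp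
qed

end

theorem theorem4p6:
  fixes q d s :: nat
    and a :: "nat \<Rightarrow> nat"
    and P :: "nat \<Rightarrow> ('a::{field, finite}) pt3 set"
    and R :: "'a pt3 set set"
    and rep :: "'a pt3 set \<Rightarrow> 'a pt3"
  assumes q_pp: "prime_power q"
    and card_field: "card (UNIV :: 'a set) = q ^ 2"
    and s_ge: "2 \<le> s" and s_le: "s \<le> d - 1" and d_le: "d - 1 \<le> q - 2"
    and a_pos: "\<forall>i\<in>{1..s}. 0 < a i"
    and a_le: "\<forall>i\<in>{1..s}. a i \<le> d + 1 - i"
    and a_sum: "(\<Sum>i=1..s. a i) \<le> 3 * d + s - 7"
    and P_on_X: "\<forall>i\<in>{1..s}. P i \<in> herm_points q"
    and P_distinct: "inj_on P {1..s}"
    and R_line: "is_line R"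
    and P_on_R: "\<forall>i\<in>{1..s}. P i \<in> R"
    and rep_ok: "\<forall>Q\<in>herm_points q - P ` {1..s}. rep Q \<in> Q"
  defines "B \<equiv> herm_points q - P ` {1..s}"
    and "C \<equiv> herm_code q d (herm_points q - P ` {1..s}) rep s P a"
  shows "card B = q ^ 3 + 1 - s \<and>
         int (code_dim C) = int ((d + 2) choose 2) - int (\<Sum>i=1..s. a i) \<and>
         min_dist B (dual_code B C) = d + 2 - s \<and>
         (\<forall>w\<in>dual_code B C. w \<noteq> 0 \<longrightarrow>
           (weight B w = d + 2 - s \<longleftrightarrow> (supp B w \<subseteq> R \<inter> B \<and> card (supp B w) = d + 2 - s))) \<and>
         (\<forall>S. S \<subseteq> R \<inter> B \<and> card S = d + 2 - s \<longrightarrow>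
           (\<exists>w\<in>dual_code B C. w \<noteq> 0 \<and> weight B w = d + 2 - s \<and> supp B w = S \<and>
              (\<forall>w'\<in>dual_code B C. w' \<noteq> 0 \<and> weight B w' = d + 2 - s \<and> supp B w' = S
                 \<longrightarrow> (\<exists>c. c \<noteq> 0 \<and> w' = fscale c w))))"
proof -
  interpret H: hermitian_field q "TYPE('a)"
    by standard (fact q_pp card_field)+
  have "\<forall>i\<in>{1..s}. \<exists>p v \<xi> \<eta>. p \<in> P i \<and> dot3 \<xi> p = 1 \<and> dot3 \<xi> v = 0 \<and> dot3 \<eta> p = 0 \<and> dot3 \<eta> v = 1 \<and>
    dot3 (tangent_form q p) v = 0 \<and>
    (\<forall>d c b. b \<le> q \<longrightarrow> vanishes_on_multpoint q d c (P i) b = (fps_X ^ b dvd form d c (tangent_curve p v)))"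
    using H.ex_tangent_frame P_on_X by blast
  then obtain p v \<xi> \<eta> where fr: "\<forall>i\<in>{1..s}. p i \<in> P i \<and> dot3 (\<xi> i) (p i) = 1 \<and> dot3 (\<xi> i) (v i) = 0 \<and>
    dot3 (\<eta> i) (p i) = 0 \<and> dot3 (\<eta> i) (v i) = 1 \<and> dot3 (tangent_form q (p i)) (v i) = 0 \<and>
    (\<forall>d c b. b \<le> q \<longrightarrow> vanishes_on_multpoint q d c (P i) b = (fps_X ^ b dvd form d c (tangent_curve (p i) (v i))))"
    unfolding bchoice_iff by blast
  interpret K: collinear_code q "TYPE('a)" d s a P R rep p v \<xi> \<eta>
  proof
    show "s < d" "d < q" using s_ge s_le d_le by linarith+
  qed (use s_ge a_pos a_le P_on_X P_distinct R_line P_on_R rep_ok fr in blast)+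
  have B: "B = K.B" by (simp add: B_def K.B_def)
  have C: "C = K.C" by (simp add: C_def K.C_def K.B_def)
  have supp_B: "supp K.B w \<subseteq> K.B" for w :: "'a pt3 set \<Rightarrow> 'a" by (auto simp: supp_def)
  \<comment> \<open>As weight is the size of the support, the content is that minimum weight forces
    the support into \<open>R\<close>.\<close>
  have weight_iff: "weight K.B w = d + 2 - s \<longleftrightarrow> (supp K.B w \<subseteq> R \<inter> K.B \<and> card (supp K.B w) = d + 2 - s)"
    if "w \<in> dual_code K.B K.C" "w \<noteq> 0" for w
    using K.dual_min_weight(2)[OF that] supp_B[of w] unfolding weight_def by auto
  have unique: "\<exists>w\<in>dual_code K.B K.C. w \<noteq> 0 \<and> weight K.B w = d + 2 - s \<and> supp K.B w = S \<and>
       (\<forall>w'\<in>dual_code K.B K.C. w' \<noteq> 0 \<and> weight K.B w' = d + 2 - s \<and> supp K.B w' = S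
          \<longrightarrow> (\<exists>c. c \<noteq> 0 \<and> w' = fscale c w))" if S: "S \<subseteq> R \<inter> K.B" "card S = d + 2 - s" for S
  proof -
    obtain w where w: "w \<in> dual_code K.B K.C" "w \<noteq> 0" "supp K.B w = S"
      using K.min_weight_word_supp[OF S] by blast
    then show ?thesis
      using K.min_weight_word_unique[OF w(1,2)] S(2) unfolding weight_def by blast
  qed
  show ?thesis
    unfolding B C
    by (intro conjI ballI allI impI K.card_B K.code_dim_C K.min_dist_dual weight_iff; (elim conjE)?)
       (assumption | rule unique)+
qed

end
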